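(* Let $d\in\mathbb{N}$, $A=(a_{ij})\in\mathbb{C}^{d\times d}$, and let $g=(g_1,\dots,g_d)^\top:[0,\infty)\to\mathbb{C}^d$ be continuous with $g(t)\to0$ as $t\to\infty$. Let $\alpha_1,\dots,\alpha_d\in(0,1]$ and assume that there exist some $\alpha^*\in(0,1]$ and some $\rho_j\in\mathbb{Q}$ such that $\alpha_j=\rho_j\alpha^*$ for all $j=1,\dots,d$. Write $\rho_j=p_j/q_j$ with positive integers $p_j,q_j$, $\gcd(p_j,q_j)=1$, let $q$ be the least common multiple of $q_1,\dots,q_d$, put $r_j=p_jq/q_j$ (so that $\alpha_j=\alpha^*r_j/q$) and $d^*=\sum_{j=1}^d r_j$, and let $A^*\in\mathbb{C}^{d^*\times d^*}$ be the block matrix described in the context. If all eigenvalues $\lambda^*$ of $A^*$ satisfy $\lambda^*\neq0$ and $|\arg\lambda^*|>\pi\alpha^*/(2q)$, then all solutions of the system $$D_*^{\alpha_i}x_i(t)=\sum_{j=1}^d a_{ij}x_j(t)+g_i(t),\qquad i=1,\dots,d,\ t>0,$$ converge to zero as $t\to\infty$.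
   Context: The matrix $A^*$ has the block structure $A^*=(A_{jk})_{j,k=1,\dots,d}$ with blocks $A_{jk}\in\mathbb{C}^{r_j\times r_k}$ defined as follows. For $j=k$, $A_{jj}$ is the $r_j\times r_j$ matrix with entries $1$ on the first superdiagonal, entry $a_{jj}$ in the lower left corner (last row, first column), and all other entries $0$ (if $r_j=1$, $A_{jj}=(a_{jj})$). For $j\ne k$, $A_{jk}$ is the $r_j\times r_k$ matrix whose entry in the last row and first column is $a_{jk}$ and whose other entries are all $0$. $D_*^{\alpha}$ denotes the Caputo derivative of order $\alpha$. By definition, a solution of the system with initial condition $x(0)=x_0=(x_1^0,\dots,x_d^0)^\top\in\mathbb{C}^d$ is a continuous function $x=(x_1,\dots,x_d)^\top:[0,\infty)\to\mathbb{C}^d$ satisfying $$x_i(t)=x_i^0+\frac{1}{\Gamma(\alpha_i)}\int_0^t(t-s)^{\alpha_i-1}\Big(\sum_{j=1}^d a_{ij}x_j(s)+g_i(s)\Big)ds\qquad\text{for all } t\ge0,\ 1\le i\le d.$$ For every $x_0\in\mathbb{C}^d$ there is exactly one such solution. The argument $\arg$ takes values in $(-\pi,\pi]$. *)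

theory Defs
  imports "HOL-Analysis.Analysis" "Jordan_Normal_Form.Char_Poly"
begin

text \<open>All indices are 0-based: the components and blocks are numbered \<open>0, \<dots>, d - 1\<close>, and a
  vector-valued function is the family of its components, of which only those with index
  below \<open>d\<close> matter.\<close>

text \<open>Riemann--Liouville integral of order \<open>\<alpha>\<close>. For \<open>\<alpha> > 0\<close> and \<open>f\<close> continuous on \<open>{0..}\<close> the
  integrand is absolutely integrable, so the integral has no default value; the value
  of \<open>powr\<close> at \<open>s = t\<close> (which is 0, also for \<open>\<alpha> = 1\<close>) only affects a null set.\<close>

definition rl_integral :: "real \<Rightarrow> (real \<Rightarrow> complex) \<Rightarrow> real \<Rightarrow> complex" where
  "rl_integral \<alpha> f t =
     of_real (1 / Gamma \<alpha>) * integral {0..t} (\<lambda>s. of_real ((t - s) powr (\<alpha> - 1)) * f s)"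

text \<open>Solutions of the Caputo system of orders \<open>\<alpha> i\<close>, with right-hand side \<open>A x + g\<close> and
  \<open>x(0) = x0\<close>, are by definition the continuous solutions of the equivalent system of Volterra
  integral equations.\<close>

definition caputo_solution ::
    "nat \<Rightarrow> complex mat \<Rightarrow> (nat \<Rightarrow> real) \<Rightarrow> (nat \<Rightarrow> real \<Rightarrow> complex) \<Rightarrow>
     (nat \<Rightarrow> complex) \<Rightarrow> (nat \<Rightarrow> real \<Rightarrow> complex) \<Rightarrow> bool" where
  "caputo_solution d A \<alpha> g x0 x \<longleftrightarrow>
     (\<forall>i<d. continuous_on {0..} (x i)) \<and>
     (\<forall>t\<ge>0. \<forall>i<d. x i t = x0 i + rl_integral (\<alpha> i) (\<lambda>s. (\<Sum>j<d. A $$ (i, j) * x j s) + g i s) t)"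

definition star_block :: "complex mat \<Rightarrow> (nat \<Rightarrow> nat) \<Rightarrow> nat \<Rightarrow> nat \<Rightarrow> complex mat" where
  "star_block A r j k = mat (r j) (r k) (\<lambda>(m, n).
     if m = r j - 1 \<and> n = 0 then A $$ (j, k)
     else if j = k \<and> n = m + 1 then 1
     else 0)"

text \<open>A global row or column index \<open>m\<close> lies in block number \<open>block_no r m\<close>, at the position
  \<open>block_pos r m\<close> inside that block, where block \<open>j\<close> has size \<open>r j\<close>.\<close>

definition block_no :: "(nat \<Rightarrow> nat) \<Rightarrow> nat \<Rightarrow> nat" where
  "block_no r m = (LEAST j. m < (\<Sum>i\<le>j. r i))"

definition block_pos :: "(nat \<Rightarrow> nat) \<Rightarrow> nat \<Rightarrow> nat" where
  "block_pos r m = m - (\<Sum>i<block_no r m. r i)"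

definition star_mat :: "nat \<Rightarrow> complex mat \<Rightarrow> (nat \<Rightarrow> nat) \<Rightarrow> complex mat" where
  "star_mat d A r = mat (\<Sum>j<d. r j) (\<Sum>j<d. r j) (\<lambda>(m, n).
     star_block A r (block_no r m) (block_no r n) $$ (block_pos r m, block_pos r n))"

lemma star_mat_carrier: "star_mat d A r \<in> carrier_mat (\<Sum>j<d. r j) (\<Sum>j<d. r j)"
  by (simp add: star_mat_def)

lemma block_no_offset:
  assumes "m < r j"
  shows "block_no r ((\<Sum>i<j. r i) + m) = j"
  unfolding block_no_def
proof (rule Least_equality)
  show "(\<Sum>i<j. r i) + m < (\<Sum>i\<le>j. r i)"
    using assms by (simp add: lessThan_Suc_atMost[symmetric])
next
  fix k assume k: "(\<Sum>i<j. r i) + m < (\<Sum>i\<le>k. r i)"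
  show "j \<le> k"
  proof (rule ccontr)
    assume "\<not> j \<le> k"
    then have "(\<Sum>i\<le>k. r i) \<le> (\<Sum>i<j. r i)"
      by (intro sum_mono2) auto
    with k show False by simp
  qed
qed

lemma block_pos_offset: "m < r j \<Longrightarrow> block_pos r ((\<Sum>i<j. r i) + m) = m"
  by (simp add: block_pos_def block_no_offset)

lemma offset_less:
  fixes r :: "nat \<Rightarrow> nat"
  assumes "j < d" "m < r j"
  shows "(\<Sum>i<j. r i) + m < (\<Sum>i<d. r i)"
proof -
  have "(\<Sum>i<Suc j. r i) \<le> (\<Sum>i<d. r i)"
    using assms by (intro sum_mono2) auto
  then show ?thesis using assms by simp
qed

text \<open>The \<open>(j, k)\<close> block of \<open>star_mat\<close> is \<open>star_block A r j k\<close>.\<close>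

lemma star_mat_block:
  assumes "j < d" "k < d" "m < r j" "n < r k"
  shows "star_mat d A r $$ ((\<Sum>i<j. r i) + m, (\<Sum>i<k. r i) + n) = star_block A r j k $$ (m, n)"
  using assms by (simp add: star_mat_def offset_less block_no_offset block_pos_offset)

end

theory Submission
  imports Defs "Jordan_Normal_Form.Schur_Decomposition"
begin

text \<open>Write $\beta = \alpha^*/q$ and refine the common order to $\delta = \beta/N$. The system becomes a
  single-order system $y = c + I^\delta(S y + G)$ whose matrix \<open>S\<close> has \<open>N\<close>-th roots of eigenvalues of
  $A^*$ as eigenvalues, and Schur triangularisation leaves scalar equations $w = c + I^\delta(\mu w + f)$
  with $f \to 0$. For large \<open>N\<close> there is \<open>n\<close> with $n\delta < 1$ and $\mathrm{Re}\,\mu^n < 0$, and the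
  geometric sum $\sum_{i<n} \mu^i I^{i\delta}$ trades $1 - \mu I^\delta$ for $1 - \mu^n I^{n\delta}$.
  In the left half-plane no asymptotics of complex Mittag-Leffler functions are needed: for large
  $M > 0$ the equation is a contraction relative to the resolvent of $I^{n\delta}$ at $-M$, whose kernel
  is nonnegative with integral $1/M$. Hence \<open>w\<close> converges, and its limit can only be zero.\<close>

section \<open>Convolution of causal functions\<close>

text \<open>The restriction n\<delta> < 1 confines the analysis to orders below one, where the
  resolvent kernel is nonnegative; its L1 norm is then its plain integral 1/M, and the contraction
  factor for \<nu> = \<mu>^n is |M + \<nu>| / M. Refinement supplies the power: the least n that
  carries n |Arg \<mu>| beyond pi/2 overshoots by at most one step, and this step costs only
  \<beta>/N in n\<delta>. The rest, pi \<beta> / (2 \<theta>) with \<theta> a lower bound for the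
  arguments of the eigenvalues, stays below 1 by the strict sector condition. A second obstacle is
  that the fractional integrals of f produced by the geometric sum need not decay, since their
  kernels are not integrable. After the resolvent has been applied, they become convolutions with
  kernels of Mittag-Leffler type, whose integrability has to be proved although they may change
  sign. Finally, the initial value acts as a constant forcing that does not decay; this is why
  convergence to some limit comes first and the limit is identified by a separate argument.\<close>

definition kconv :: "(real \<Rightarrow> real) \<Rightarrow> (real \<Rightarrow> 'a::{banach, second_countable_topology}) \<Rightarrow> real \<Rightarrow> 'a" where
  "kconv K f t = (\<integral>s. K (t - s) *\<^sub>R f s \<partial>lborel)"

text \<open>Causality of both factors turns the whole-line integral of \<open>kconv\<close> into one
  over {0..t}, so no interval of integration has to be carried along. Integrability is asked only up
  to each T, because the kernels t^(a-1) are not integrable at infinity.\<close>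

definition loc_int :: "(real \<Rightarrow> real) \<Rightarrow> bool" where
  "loc_int K \<longleftrightarrow> K \<in> borel_measurable borel \<and> (\<forall>t<0. K t = 0) \<and>
     (\<forall>T. integrable lborel (\<lambda>t. indicator {..T} t * K t))"

definition loc_bdd :: "(real \<Rightarrow> 'a::{banach, second_countable_topology}) \<Rightarrow> bool" where
  "loc_bdd f \<longleftrightarrow> f \<in> borel_measurable borel \<and> (\<forall>t<0. f t = 0) \<and> (\<forall>T. \<exists>B. \<forall>t\<le>T. norm (f t) \<le> B)"

lemma loc_int_measurable: "loc_int K \<Longrightarrow> K \<in> borel_measurable borel"
  and loc_int_neg: "loc_int K \<Longrightarrow> t < 0 \<Longrightarrow> K t = 0"
  and loc_int_integrable: "loc_int K \<Longrightarrow> integrable lborel (\<lambda>t. indicator {..T} t * K t)"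
  by (auto simp: loc_int_def)

lemma loc_bdd_measurable: "loc_bdd f \<Longrightarrow> f \<in> borel_measurable borel"
  and loc_bdd_neg: "loc_bdd f \<Longrightarrow> t < 0 \<Longrightarrow> f t = 0"
  by (auto simp: loc_bdd_def)

lemma loc_bddE:
  assumes "loc_bdd f"
  obtains B where "B \<ge> 0" "\<And>t. t \<le> T \<Longrightarrow> norm (f t) \<le> B"
proof -
  obtain B where B: "\<forall>t\<le>T. norm (f t) \<le> B"
    using assms unfolding loc_bdd_def by blast
  show ?thesis
    by (rule that[of "\<bar>B\<bar>"]) (use B in \<open>auto intro: order_trans\<close>)
qed

lemma loc_int_norm_integrable:
  "loc_int K \<Longrightarrow> integrable lborel (\<lambda>t. indicator {..T} t * \<bar>K t\<bar>)"
  using integrable_abs[OF loc_int_integrable[of K T]] by (simp add: abs_mult)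

lemma loc_int_reflect_integrable:
  assumes "loc_int K"
  shows "integrable lborel (\<lambda>s. indicator {..T} (t - s) * \<bar>K (t - s)\<bar>)"
  using lborel_integrable_real_affine[OF loc_int_norm_integrable[OF assms], of "-1" T t] by simp

lemma loc_int_reflect_integral:
  "(\<integral>s. indicator {..T} (t - s) * \<bar>K (t - s)\<bar> \<partial>lborel) = (\<integral>s. indicator {..T} s * \<bar>K s\<bar> \<partial>lborel)"
  for K :: "real \<Rightarrow> real"
  using lborel_integral_real_affine[of "-1" "\<lambda>s. indicator {..T} s * \<bar>K s\<bar>" t] by simp

text \<open>For 0 \<le> s \<le> t the argument t - s lies below T, so the truncation is invisible;
  elsewhere one of the two factors vanishes. The integral of the majorant does not depend on t,
  which gives bounds uniform on {..T}.\<close>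

lemma kconv_dominated:
  assumes K: "loc_int K" and f: "loc_bdd f" and B: "\<And>s. s \<le> T \<Longrightarrow> norm (f s) \<le> B" and t: "t \<le> T"
  shows "norm (K (t - s) *\<^sub>R f s) \<le> B * (indicator {..T} (t - s) * \<bar>K (t - s)\<bar>)"
proof -
  have "B \<ge> 0" using B[of T] order_trans[OF norm_ge_zero] by blast
  then show ?thesis
    using loc_int_neg[OF K, of "t - s"] loc_bdd_neg[OF f, of s] B[of s] t
    by (cases "s < 0"; cases "s > t") (auto simp: mult.commute mult_right_mono split: split_indicator)
qed

lemma kconv_integrable:
  assumes K: "loc_int K" and f: "loc_bdd f"
  shows "integrable lborel (\<lambda>s. K (t - s) *\<^sub>R f s)"
proof -
  obtain B where B: "\<And>s. s \<le> t \<Longrightarrow> norm (f s) \<le> B" using loc_bddE[OF f] by blast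
  note [measurable] = loc_int_measurable[OF K] loc_bdd_measurable[OF f]
  show ?thesis
  proof (rule Bochner_Integration.integrable_bound)
    show "integrable lborel (\<lambda>s. B * (indicator {..t} (t - s) * \<bar>K (t - s)\<bar>))"
      by (rule integrable_mult_right) (rule loc_int_reflect_integrable[OF K])
    show "AE s in lborel. norm (K (t - s) *\<^sub>R f s) \<le> norm (B * (indicator {..t} (t - s) * \<bar>K (t - s)\<bar>))"
      using order_trans[OF kconv_dominated[OF K f B order_refl] abs_ge_self] by simp
  qed measurable
qed

lemma kconv_norm_le:
  assumes K: "loc_int K" and f: "loc_bdd f" and B: "\<And>s. s \<le> T \<Longrightarrow> norm (f s) \<le> B" and t: "t \<le> T"
  shows "norm (kconv K f t) \<le> B * (\<integral>s. indicator {..T} s * \<bar>K s\<bar> \<partial>lborel)"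
proof -
  have "norm (kconv K f t) \<le> (\<integral>s. B * (indicator {..T} (t - s) * \<bar>K (t - s)\<bar>) \<partial>lborel)"
    unfolding kconv_def
    by (rule Bochner_Integration.integral_norm_bound_integral[OF kconv_integrable[OF K f] integrable_mult_right[OF loc_int_reflect_integrable[OF K]]])
       (rule kconv_dominated[OF K f B t])
  then show ?thesis by (simp add: loc_int_reflect_integral)
qed

lemma kconv_neg: "loc_int K \<Longrightarrow> loc_bdd f \<Longrightarrow> t < 0 \<Longrightarrow> kconv K f t = 0"
  unfolding kconv_def
  by (rule integral_eq_zero_AE, rule AE_I2) (metis diff_less_eq add_0 linorder_not_less loc_bdd_neg loc_int_neg order.strict_trans1 scaleR_eq_0_iff)

lemma kconv_loc_bdd:
  fixes f :: "real \<Rightarrow> 'a::{banach, second_countable_topology}"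
  assumes K: "loc_int K" and f: "loc_bdd f"
  shows "loc_bdd (kconv K f)"
proof -
  note [measurable] = loc_int_measurable[OF K] loc_bdd_measurable[OF f]
  have "kconv K f \<in> borel_measurable borel" unfolding kconv_def by measurable
  moreover have "\<exists>B. \<forall>t\<le>T. norm (kconv K f t) \<le> B" for T
  proof -
    obtain B where B: "\<And>s. s \<le> T \<Longrightarrow> norm (f s) \<le> B" using loc_bddE[OF f] by blast
    show ?thesis using kconv_norm_le[OF K f B] by blast
  qed
  ultimately show ?thesis
    by (simp add: loc_bdd_def kconv_neg[OF K f])
qed

lemma loc_bdd_add: "loc_bdd f \<Longrightarrow> loc_bdd g \<Longrightarrow> loc_bdd (\<lambda>t. f t + g t)"
  unfolding loc_bdd_def by (auto, metis add_mono norm_triangle_le)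

lemma loc_bdd_mult:
  fixes f :: "real \<Rightarrow> complex" shows "loc_bdd f \<Longrightarrow> loc_bdd (\<lambda>t. c * f t)"
  unfolding loc_bdd_def by (auto simp: norm_mult, metis mult_left_mono norm_ge_zero)

lemma loc_bdd_zero: "loc_bdd (\<lambda>t. 0)"
  by (auto simp: loc_bdd_def intro!: exI[of _ 0])

lemma loc_bdd_step: "loc_bdd (indicator {0..} :: real \<Rightarrow> 'a::{banach, second_countable_topology,real_normed_algebra_1})"
  by (auto simp: loc_bdd_def intro!: exI[of _ 1] split: split_indicator)

lemma loc_bdd_sum: "(\<And>i. i \<in> I \<Longrightarrow> loc_bdd (f i)) \<Longrightarrow> loc_bdd (\<lambda>t. \<Sum>i\<in>I. f i t)"
  by (induction I rule: infinite_finite_induct) (auto intro: loc_bdd_add loc_bdd_zero)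

lemma kconv_add:
  assumes "loc_int K" "loc_bdd f" "loc_bdd g"
  shows "kconv K (\<lambda>t. f t + g t) t = kconv K f t + kconv K g t"
  using kconv_integrable[OF assms(1,2), of t] kconv_integrable[OF assms(1,3), of t]
  by (simp add: kconv_def scaleR_add_right)

lemma kconv_mult:
  fixes f :: "real \<Rightarrow> complex" shows "kconv K (\<lambda>t. c * f t) t = c * kconv K f t"
  by (simp add: kconv_def mult_scaleR_right flip: integral_mult_right_zero)

lemma kconv_sum:
  assumes "loc_int K" "\<And>i. i \<in> I \<Longrightarrow> loc_bdd (f i)"
  shows "kconv K (\<lambda>t. \<Sum>i\<in>I. f i t) t = (\<Sum>i\<in>I. kconv K (f i) t)"
  using assms(2)
  by (induction I rule: infinite_finite_induct)
     (auto simp: kconv_add[OF assms(1)] loc_bdd_sum, simp_all add: kconv_def)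

lemma kconv_kernel_diff:
  assumes "loc_int K" "loc_int L" "loc_bdd f"
  shows "kconv (\<lambda>t. K t - c * L t) f t = kconv K f t - c *\<^sub>R kconv L f t"
  using kconv_integrable[OF assms(1,3), of t] kconv_integrable[OF assms(2,3), of t]
  by (simp add: kconv_def scaleR_left_diff_distrib flip: scaleR_scaleR)

lemma kconv_commute: "kconv K f t = (\<integral>s. K s *\<^sub>R f (t - s) \<partial>lborel)"
  unfolding kconv_def
  using lborel_integral_real_affine[of "-1" "\<lambda>s. K (t - s) *\<^sub>R f s" t] by simp

text \<open>Without integrability both sides are the default value 0. This is needed for
  associativity: the convolution of two singular kernels may fail to exist at single points, and no
  such point has to be excluded.\<close>

lemma integral_scaleR_left_total:
  fixes c :: "'a::{banach, second_countable_topology}"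
  assumes f: "f \<in> borel_measurable M"
  shows "(\<integral>x. f x *\<^sub>R c \<partial>M) = (\<integral>x. f x \<partial>M) *\<^sub>R c"
proof (cases "c = 0 \<or> integrable M f")
  case False
  then have "\<not> integrable M (\<lambda>x. f x *\<^sub>R c)"
  proof (intro notI)
    assume "integrable M (\<lambda>x. f x *\<^sub>R c)"
    from integrable_mult_left[OF integrable_norm[OF this], of "inverse (norm c)"] False
    have "integrable M (\<lambda>x. norm (f x))" by simp
    with f False integrable_norm_cancel[of M f] show False by blast
  qed
  with False show ?thesis by (simp add: not_integrable_integral_eq)
qed auto

text \<open>Fubini on the product of two copies of the line, followed by a translation in the inner
  integral.\<close>

lemma kconv_assoc:
  assumes K: "loc_int K" and L: "loc_int L" and f: "loc_bdd f"
  shows "kconv K (kconv L f) t = kconv (kconv K L) f t"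
proof -
  note [measurable] = loc_int_measurable[OF K] loc_int_measurable[OF L] loc_bdd_measurable[OF f]
  define F where "F = (\<lambda>s r. K (t - s) *\<^sub>R L (s - r) *\<^sub>R f r)"
  obtain B where B0: "B \<ge> 0" and B: "\<And>s. s \<le> t \<Longrightarrow> norm (f s) \<le> B" using loc_bddE[OF f] by blast
  \<comment> \<open>\<open>C\<close> bounds the integral of |L (s - r)| |f r| over r uniformly in s
    \<le> t, so the iterated integral of the norms is dominated by \<open>C\<close> times a
    truncation of |K|.\<close>
  define C where "C = B * (\<integral>s. indicator {..t} s * \<bar>L s\<bar> \<partial>lborel)"
  have intF: "integrable lborel (F s)" for s
    unfolding F_def by (rule integrable_scaleR_right) (rule kconv_integrable[OF L f])
  have int: "integrable (lborel \<Otimes>\<^sub>M lborel) (case_prod F)"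
  proof (rule lborel_pair.Fubini_integrable)
    show "AE s in lborel. integrable lborel (\<lambda>r. case_prod F (s, r))"
      using intF by simp
    show "integrable lborel (\<lambda>s. \<integral>r. norm (case_prod F (s, r)) \<partial>lborel)"
    proof (rule Bochner_Integration.integrable_bound)
      show "integrable lborel (\<lambda>s. C * (indicator {..t} (t - s) * \<bar>K (t - s)\<bar>))"
        by (rule integrable_mult_right) (rule loc_int_reflect_integrable[OF K])
      show "AE s in lborel. norm (\<integral>r. norm (case_prod F (s, r)) \<partial>lborel)
          \<le> norm (C * (indicator {..t} (t - s) * \<bar>K (t - s)\<bar>))"
      proof (rule AE_I2)
        fix s
        have "(\<integral>r. norm (F s r) \<partial>lborel) \<le> C * (indicator {..t} (t - s) * \<bar>K (t - s)\<bar>)"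
        proof (cases "s < 0 \<or> s > t")
          case True
          then have "F s r = 0" for r
            unfolding F_def using loc_int_neg[OF K, of "t-s"] loc_int_neg[OF L, of "s-r"] loc_bdd_neg[OF f, of r]
            by (cases "r < 0") auto
          moreover have "C \<ge> 0" unfolding C_def using B0
            by (intro mult_nonneg_nonneg integral_nonneg_AE) (auto split: split_indicator)
          ultimately show ?thesis by simp
        next
          case False
          have "(\<integral>r. norm (F s r) \<partial>lborel) \<le> (\<integral>r. (\<bar>K (t - s)\<bar> * B) * (indicator {..t} (s - r) * \<bar>L (s - r)\<bar>) \<partial>lborel)"
          proof (rule integral_mono)
            show "integrable lborel (\<lambda>r. norm (F s r))" by (rule integrable_norm[OF intF])
            show "integrable lborel (\<lambda>r. \<bar>K (t - s)\<bar> * B * (indicator {..t} (s - r) * \<bar>L (s - r)\<bar>))"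
              by (rule integrable_mult_right) (rule loc_int_reflect_integrable[OF L])
            fix r
            have "norm (L (s - r) *\<^sub>R f r) \<le> B * (indicator {..t} (s - r) * \<bar>L (s - r)\<bar>)"
              by (rule kconv_dominated[OF L f B]) (use False in auto)
            then show "norm (F s r) \<le> \<bar>K (t - s)\<bar> * B * (indicator {..t} (s - r) * \<bar>L (s - r)\<bar>)"
              unfolding F_def using mult_left_mono[of _ _ "\<bar>K (t - s)\<bar>", OF _ abs_ge_zero]
              by (simp add: mult.assoc abs_mult)
          qed
          also have "\<dots> = C * (indicator {..t} (t - s) * \<bar>K (t - s)\<bar>)"
            using False by (simp add: C_def loc_int_reflect_integral)
          finally show ?thesis .
        qed
        moreover have "(\<integral>r. norm (F s r) \<partial>lborel) \<ge> 0" by simp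
        ultimately show "norm (\<integral>r. norm (case_prod F (s, r)) \<partial>lborel)
          \<le> norm (C * (indicator {..t} (t - s) * \<bar>K (t - s)\<bar>))" by simp
      qed
      show "(\<lambda>s. \<integral>r. norm (case_prod F (s, r)) \<partial>lborel) \<in> borel_measurable lborel"
        unfolding F_def by measurable
    qed
    show "case_prod F \<in> borel_measurable (lborel \<Otimes>\<^sub>M lborel)"
      unfolding F_def by measurable
  qed
  have "kconv K (kconv L f) t = (\<integral>s. \<integral>r. F s r \<partial>lborel \<partial>lborel)"
    by (simp add: kconv_def F_def del: scaleR_scaleR)
  also have "\<dots> = (\<integral>r. \<integral>s. F s r \<partial>lborel \<partial>lborel)"
    using lborel_pair.Fubini_integral[OF int] by simp
  also have "\<dots> = (\<integral>r. kconv K L (t - r) *\<^sub>R f r \<partial>lborel)"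
  proof (rule Bochner_Integration.integral_cong[OF refl])
    fix r
    have "(\<integral>s. F s r \<partial>lborel) = (\<integral>s. K (t - s) * L (s - r) \<partial>lborel) *\<^sub>R f r"
      unfolding F_def by (simp add: flip: integral_scaleR_left_total)
    also have "(\<integral>s. K (t - s) * L (s - r) \<partial>lborel) = kconv K L (t - r)"
      using lborel_integral_real_affine[of 1 "\<lambda>s. K (t - s) * L (s - r)" r]
      by (simp add: kconv_def algebra_simps)
    finally show "(\<integral>s. F s r \<partial>lborel) = kconv K L (t - r) *\<^sub>R f r" .
  qed
  finally show ?thesis by (simp add: kconv_def)
qed

text \<open>An integrable kernel maps convergent functions to convergent ones: dominated convergence, after
  the translation has been moved to \<open>f\<close>.\<close>

lemma kconv_tendsto:
  fixes f :: "real \<Rightarrow> 'a::{banach, second_countable_topology}"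
  assumes K: "integrable lborel K" and [measurable]: "f \<in> borel_measurable borel"
    and B: "\<And>t. norm (f t) \<le> B" and lim: "(f \<longlongrightarrow> l) at_top"
  shows "(kconv K f \<longlongrightarrow> (\<integral>s. K s \<partial>lborel) *\<^sub>R l) at_top"
proof -
  have [measurable]: "K \<in> borel_measurable borel" using K by auto
  have "((\<lambda>t. \<integral>s. K s *\<^sub>R f (t - s) \<partial>lborel) \<longlongrightarrow> (\<integral>s. K s *\<^sub>R l \<partial>lborel)) at_top"
  proof (rule integral_dominated_convergence_at_top)
    show "integrable lborel (\<lambda>s. \<bar>K s\<bar> * B)" using K by auto
    show "\<forall>\<^sub>F t in at_top. AE s in lborel. norm (K s *\<^sub>R f (t - s)) \<le> \<bar>K s\<bar> * B"
      using B by (auto intro!: always_eventually mult_left_mono)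
    show "AE s in lborel. ((\<lambda>t. K s *\<^sub>R f (t - s)) \<longlongrightarrow> K s *\<^sub>R l) at_top"
    proof (rule AE_I2)
      fix s :: real
      have "filterlim (\<lambda>t. -s + t) at_top at_top"
        by (rule filterlim_tendsto_add_at_top[OF tendsto_const filterlim_ident])
      from filterlim_compose[OF lim this]
      show "((\<lambda>t. K s *\<^sub>R f (t - s)) \<longlongrightarrow> K s *\<^sub>R l) at_top"
        by (intro tendsto_scaleR tendsto_const) simp
    qed
  qed measurable
  then show ?thesis
    by (simp add: kconv_commute[abs_def] K)
qed

section \<open>Mittag-Leffler kernels\<close>

definition rl_kernel :: "real \<Rightarrow> real \<Rightarrow> real" where
  "rl_kernel a t = (if t > 0 then t powr (a - 1) / Gamma a else 0)"

lemma rl_kernel_nonneg: "a > 0 \<Longrightarrow> rl_kernel a t \<ge> 0"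
  by (simp add: rl_kernel_def)

lemma rl_kernel_pos: "a > 0 \<Longrightarrow> t > 0 \<Longrightarrow> rl_kernel a t > 0"
  by (simp add: rl_kernel_def)

lemma rl_kernel_measurable [measurable]: "rl_kernel a \<in> borel_measurable borel"
  unfolding rl_kernel_def by measurable

lemma rl_kernel_one: "t > 0 \<Longrightarrow> rl_kernel 1 t = 1"
  by (simp add: rl_kernel_def)

lemma rl_kernel_loc_int:
  assumes "a > 0"
  shows "loc_int (rl_kernel a)"
proof -
  have "integrable lborel (\<lambda>t. indicator {..T} t * rl_kernel a t)" for T
  proof -
    have "(\<lambda>t. t powr (a - 1)) absolutely_integrable_on {0..max T 0}"
      using has_integral_powr_from_0[of "a - 1" "max T 0"] assms
      by (intro nonnegative_absolutely_integrable_1) (auto simp: integrable_on_def)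
    then have "integrable lborel (\<lambda>t. indicator {0..max T 0} t *\<^sub>R t powr (a - 1))"
      unfolding set_integrable_def by (subst (asm) integrable_completion) auto
    from integrable_mult_left[OF this, of "1 / Gamma a"]
    have "integrable lborel (\<lambda>t. indicator {0..max T 0} t * t powr (a - 1) / Gamma a)" by simp
    also have "(\<lambda>t. indicator {0..max T 0} t * t powr (a - 1) / Gamma a) = (\<lambda>t. indicator {..T} t * rl_kernel a t)"
      by (rule ext) (auto simp: rl_kernel_def split: split_indicator)
    finally show ?thesis .
  qed
  then show ?thesis by (simp add: loc_int_def) (simp add: rl_kernel_def)
qed

text \<open>The substitution s = t v turns the integral into Euler's Beta integral. Integrability is
  proved alongside because \<open>kconv_integrable\<close> asks for a locally bounded second factor,
  and \<open>rl_kernel b\<close> is unbounded at 0 for b < 1.\<close>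

lemma
  assumes a: "a > 0" and b: "b > 0"
  shows rl_kernel_prod_integrable: "integrable lborel (\<lambda>s. rl_kernel a (t - s) * rl_kernel b s)" (is ?A)
    and kconv_rl_kernel: "kconv (rl_kernel a) (rl_kernel b) t = rl_kernel (a + b) t" (is ?B)
proof -
  let ?g = "\<lambda>s. rl_kernel a (t - s) * rl_kernel b s"
  have "?A \<and> ?B"
  proof (cases "t > 0")
    case False
    then have g: "?g = (\<lambda>s. 0)" by (auto simp: rl_kernel_def)
    have ?B unfolding kconv_def real_scaleR_def g using False by (simp add: rl_kernel_def)
    then show ?thesis unfolding g by simp
  next
    case t: True
    define h where "h v = indicator {0..1} v *\<^sub>R (v powr (b - 1) * (1 - v) powr (a - 1))" for v :: real
    have h: "integrable lborel h" "integral\<^sup>L lborel h = Beta b a"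
      using integrable_Beta[OF b a] set_borel_integral_eq_integral(2)[OF integrable_Beta[OF b a]]
        has_integral_Beta_real[OF b a]
      by (auto simp: h_def[abs_def] set_integrable_def set_lebesgue_integral_def integral_unique)
    define c where "c = t powr (a + b - 2) / (Gamma a * Gamma b)"
    have eq: "?g (0 + t * v) = c * h v" for v
    proof (cases "0 < v \<and> v < 1")
      case True
      have "t - t * v = t * (1 - v)" by (simp add: algebra_simps)
      moreover have "t powr (a - 1) * t powr (b - 1) = t powr (a + b - 2)"
        by (simp flip: powr_add)
      ultimately have E: "(t - t * v) powr (a - 1) * (t * v) powr (b - 1) = t powr (a + b - 2) * ((1 - v) powr (a - 1) * v powr (b - 1))"
        using True t by (simp add: powr_mult)
      have h: "h v = (1 - v) powr (a - 1) * v powr (b - 1)" using True by (simp add: h_def)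
      have "0 < t - t * v" "0 < t * v" using True t by auto
      then have "?g (0 + t * v) = (t - t * v) powr (a - 1) * (t * v) powr (b - 1) / (Gamma a * Gamma b)"
        unfolding rl_kernel_def add_0 by (simp only: if_True times_divide_times_eq)
      then show ?thesis by (simp only: E h c_def times_divide_eq_left)
    next
      case False
      then have "\<not> 0 < t * v \<or> \<not> 0 < t - t * v" using t by (auto simp: zero_less_mult_iff)
      then have "?g (0 + t * v) = 0" unfolding rl_kernel_def by auto
      moreover have "h v = 0" using False by (auto simp: h_def split: split_indicator)
      ultimately show ?thesis by simp
    qed
    have "integrable lborel (\<lambda>v. ?g (0 + t * v))"
      unfolding eq using h(1) by simp
    then have A: ?A using lborel_integrable_real_affine_iff[of t ?g 0] t by simp
    have "kconv (rl_kernel a) (rl_kernel b) t = t * (\<integral>v. ?g (0 + t * v) \<partial>lborel)"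
      unfolding kconv_def using lborel_integral_real_affine[of t ?g 0] t by simp
    also have "\<dots> = t * c * Beta b a" unfolding eq using h by simp
    also have "\<dots> = rl_kernel (a + b) t"
    proof -
      have "t * t powr (a + b - 2) = t powr (a + b - 1)"
        using t by (simp add: powr_mult_base)
      then show ?thesis
        using t less_imp_neq[OF Gamma_real_pos[OF a]] less_imp_neq[OF Gamma_real_pos[OF b]]
          less_imp_neq[OF Gamma_real_pos[OF add_pos_pos[OF a b]]]
        by (simp add: rl_kernel_def c_def Beta_def add.commute field_simps)
    qed
    finally show ?thesis using A by simp
  qed
  then show ?A ?B by auto
qed

text \<open>Primitives become convolutions with the unit step, so the semigroup law evaluates them.
  The two integrands can differ only at s = T, where \<open>rl_kernel 1 0\<close> is 0.\<close>

lemma integral_atMost_eq_kconv: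
  assumes "loc_int K"
  shows "(\<integral>s. indicator {..T} s * K s \<partial>lborel) = kconv (rl_kernel 1) K T"
  unfolding kconv_def
proof (rule integral_cong_AE)
  show "AE s in lborel. indicator {..T} s * K s = rl_kernel 1 (T - s) *\<^sub>R K s"
    using AE_lborel_singleton[of T]
    by eventually_elim (auto simp: rl_kernel_def split: split_indicator)
qed (use loc_int_measurable[OF assms] in measurable)

section \<open>Mittag-Leffler series: convergence, convolution law, behaviour near zero\<close>

lemma powr_add_nat_mult:
  assumes "(t :: real) > 0"
  shows "t powr (c + real j * \<gamma>) = t powr c * (t powr \<gamma>) ^ j"
  using assms by (simp add: powr_add powr_power)

text \<open>Only the part of Euler's integral over {b..b+1} is kept. Since b is free, Gamma outgrows
  every geometric sequence, and so the Mittag-Leffler series converges for all arguments.\<close>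

lemma Gamma_lower_bound:
  assumes x: "x \<ge> 1" and b: "b > 0"
  shows "b powr (x - 1) / exp (b + 1) \<le> Gamma (x :: real)"
proof -
  let ?f = "\<lambda>t. t powr (x - 1) / exp t :: real"
  have int: "?f integrable_on {b..b+1}"
    by (rule integrable_continuous_interval) (use b in \<open>auto intro!: continuous_intros\<close>)
  have "b powr (x - 1) / exp (b + 1) = integral {b..b+1} (\<lambda>t. b powr (x - 1) / exp (b + 1))"
    by simp
  also have "\<dots> \<le> integral {b..b+1} ?f"
    by (rule integral_le[OF _ int]) (use b x in \<open>auto intro!: frac_le powr_mono2\<close>)
  also have "\<dots> \<le> integral {0..} ?f"
    using b Gamma_integral_real[of x] x
    by (intro integral_subset_le int) (auto simp: integrable_on_def)
  also have "\<dots> = Gamma x" using Gamma_integral_real[of x] x by (simp add: integral_unique)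
  finally show ?thesis .
qed

text \<open>\<open>ml_kernel \<gamma> M a\<close> is $t^{a-1} E_{\gamma,a}(-M t^\gamma)$ with the Mittag-Leffler function \<open>E\<close>; its
  Laplace transform is $s^{\gamma-a} / (s^\gamma + M)$.\<close>

definition ml_kernel :: "real \<Rightarrow> real \<Rightarrow> real \<Rightarrow> real \<Rightarrow> real" where
  "ml_kernel \<gamma> M a t = (\<Sum>j. (- M) ^ j * rl_kernel (a + real j * \<gamma>) t)"

context
  fixes \<gamma> M :: real
  assumes \<gamma>: "\<gamma> > 0" and M: "M > 0"
begin

lemma ml_order_pos: "a > 0 \<Longrightarrow> a + real j * \<gamma> > 0"
  using \<gamma> by (simp add: add_pos_nonneg)

lemma summable_ml_abs:
  assumes a: "a > 0"
  shows "summable (\<lambda>j. M ^ j * rl_kernel (a + real j * \<gamma>) t)"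
proof (cases "t > 0")
  case False
  then show ?thesis by (simp add: rl_kernel_def)
next
  case t: True
  \<comment> \<open>Chosen so that (t / b)^\<gamma> = 1 / (2 M), which makes the majorant geometric
    with ratio 1/2.\<close>
  define b where "b = t * (2 * M) powr (1 / \<gamma>)"
  have b: "b > 0" using t M by (simp add: b_def)
  define C where "C = exp (b + 1) * (t / b) powr (a - 1)"
  have tb: "(t / b) powr \<gamma> = 1 / (2 * M)"
    using t M \<gamma> by (simp add: b_def powr_divide powr_powr powr_mult)
  show ?thesis
  proof (rule summable_comparison_test_ev)
    show "summable (\<lambda>j. C * (1 / 2) ^ j)"
      by (intro summable_mult summable_geometric) simp
    show "\<forall>\<^sub>F j in sequentially. norm (M ^ j * rl_kernel (a + real j * \<gamma>) t) \<le> C * (1 / 2) ^ j"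
    proof (rule eventually_sequentiallyI)
      \<comment> \<open>From this index on the order is at least 1, as
        \<open>Gamma_lower_bound\<close> requires.\<close>
      fix j assume "nat \<lceil>1 / \<gamma>\<rceil> \<le> j"
      then have "1 / \<gamma> \<le> real j" by (simp add: nat_le_iff ceiling_le_iff)
      then have j: "a + real j * \<gamma> \<ge> 1" using \<gamma> a by (simp add: field_simps)
      let ?x = "a + real j * \<gamma>"
      have "t powr (?x - 1) / Gamma ?x \<le> t powr (?x - 1) / (b powr (?x - 1) / exp (b + 1))"
        using Gamma_lower_bound[OF j b] b t j by (intro divide_left_mono mult_pos_pos) auto
      also have "\<dots> = exp (b + 1) * (t / b) powr (?x - 1)"
        using t b by (simp add: powr_divide)
      also have "(t / b) powr (?x - 1) = (t / b) powr (a - 1) * (1 / (2 * M)) ^ j"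
      proof -
        have "?x - 1 = (a - 1) + real j * \<gamma>" by simp
        then show ?thesis using powr_add_nat_mult[of "t / b" "a - 1" j \<gamma>] t b by (simp only: tb) simp
      qed
      finally have "rl_kernel ?x t \<le> C * (1 / (2 * M)) ^ j"
        using t by (simp add: rl_kernel_def C_def)
      then have "M ^ j * rl_kernel ?x t \<le> M ^ j * (C * (1 / (2 * M)) ^ j)"
        using M by (intro mult_left_mono) auto
      also have "\<dots> = C * (1 / 2) ^ j" using M by (simp add: power_divide power_mult_distrib)
      finally show "norm (M ^ j * rl_kernel ?x t) \<le> C * (1 / 2) ^ j"
        using M rl_kernel_nonneg[OF ml_order_pos[OF a], of j t] by (simp add: abs_mult)
    qed
  qed
qed

lemma norm_ml_term:
  "a > 0 \<Longrightarrow> norm ((- M) ^ j * rl_kernel (a + real j * \<gamma>) t) = M ^ j * rl_kernel (a + real j * \<gamma>) t"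
  using M rl_kernel_nonneg[OF ml_order_pos, of a j t] by (simp add: abs_mult power_abs)

lemma summable_ml: "a > 0 \<Longrightarrow> summable (\<lambda>j. (- M) ^ j * rl_kernel (a + real j * \<gamma>) t)"
  by (rule summable_norm_cancel) (simp add: norm_ml_term summable_ml_abs del: real_norm_def)

lemma ml_kernel_measurable [measurable]: "ml_kernel \<gamma> M a \<in> borel_measurable borel"
  unfolding ml_kernel_def[abs_def] by measurable

lemma ml_kernel_nonpos_arg: "t \<le> 0 \<Longrightarrow> ml_kernel \<gamma> M a t = 0"
  by (simp add: ml_kernel_def rl_kernel_def)

text \<open>Termwise integration. Each order rises by b, and the integrals of the absolute values
  form the series of order a + b with M in place of -M, which converges by
  \<open>summable_ml_abs\<close>.\<close>

lemma
  assumes a: "a > 0" and b: "b > 0"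
  shows ml_kernel_prod_integrable: "integrable lborel (\<lambda>s. rl_kernel b (t - s) * ml_kernel \<gamma> M a s)"
    and kconv_rl_ml_kernel: "kconv (rl_kernel b) (ml_kernel \<gamma> M a) t = ml_kernel \<gamma> M (a + b) t"
proof -
  let ?f = "\<lambda>j s. (- M) ^ j * (rl_kernel b (t - s) * rl_kernel (a + real j * \<gamma>) s)"
  have eq: "(\<Sum>j. ?f j s) = rl_kernel b (t - s) * ml_kernel \<gamma> M a s" for s
    unfolding ml_kernel_def using suminf_mult[OF summable_ml[OF a], of "rl_kernel b (t - s)" s]
    by (simp add: mult_ac)
  have norm: "norm (?f j s) = M ^ j * (rl_kernel b (t - s) * rl_kernel (a + real j * \<gamma>) s)" for j s
    using norm_ml_term[OF a, of j s] rl_kernel_nonneg[OF b, of "t - s"] M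
    rl_kernel_nonneg[OF ml_order_pos[OF a], of j s]
    by (simp add: abs_mult power_abs)
  have int: "(\<integral>s. rl_kernel b (t - s) * rl_kernel (a + real j * \<gamma>) s \<partial>lborel) = rl_kernel (a + b + real j * \<gamma>) t" for j
    using kconv_rl_kernel[OF b ml_order_pos[OF a], of j t] by (simp add: kconv_def add_ac)
  have 1: "integrable lborel (?f j)" for j
    by (intro integrable_mult_right rl_kernel_prod_integrable ml_order_pos a b)
  have 2: "AE s in lborel. summable (\<lambda>j. norm (?f j s))"
    unfolding norm mult.left_commute[of "M ^ _"]
    by (intro AE_I2 summable_mult summable_ml_abs a)
  have 3: "summable (\<lambda>j. \<integral>s. norm (?f j s) \<partial>lborel)"
    unfolding norm using summable_ml_abs[of "a + b" t] a b by (simp add: int)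
  show "integrable lborel (\<lambda>s. rl_kernel b (t - s) * ml_kernel \<gamma> M a s)"
    using integrable_suminf[OF 1 2 3] by (simp only: eq)
  show "kconv (rl_kernel b) (ml_kernel \<gamma> M a) t = ml_kernel \<gamma> M (a + b) t"
    using integral_suminf[OF 1 2 3] unfolding eq
    by (simp add: kconv_def int) (simp add: ml_kernel_def)
qed

lemma ml_kernel_loc_int:
  assumes a: "a > 0"
  shows "loc_int (ml_kernel \<gamma> M a)"
proof -
  have "integrable lborel (\<lambda>t. indicator {..T} t * ml_kernel \<gamma> M a t)" for T
  proof (rule integrable_cong_AE_imp[OF ml_kernel_prod_integrable[of a 1 T]])
    show "AE s in lborel. rl_kernel 1 (T - s) * ml_kernel \<gamma> M a s = indicator {..T} s * ml_kernel \<gamma> M a s"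
      using AE_lborel_singleton[of T]
      by eventually_elim (auto simp: rl_kernel_def split: split_indicator)
  qed (use a in simp_all)
  then show ?thesis by (simp add: loc_int_def ml_kernel_nonpos_arg)
qed

text \<open>The term j = 0 is split off. On the Laplace side, s^(\<gamma>-a) / (s^\<gamma> + M) =
  s^(-a) - M s^(-a) / (s^\<gamma> + M); for a = \<gamma> this is the resolvent equation.\<close>

lemma ml_kernel_recurrence:
  assumes a: "a > 0"
  shows "ml_kernel \<gamma> M a t = rl_kernel a t - M * ml_kernel \<gamma> M (a + \<gamma>) t"
proof -
  have "ml_kernel \<gamma> M a t = (\<Sum>j. (- M) ^ Suc j * rl_kernel (a + real (Suc j) * \<gamma>) t) + rl_kernel a t"
    unfolding ml_kernel_def using suminf_split_head[OF summable_ml[OF a], of t] by simp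
  also have "(\<lambda>j. (- M) ^ Suc j * rl_kernel (a + real (Suc j) * \<gamma>) t) =
      (\<lambda>j. (- M) * ((- M) ^ j * rl_kernel (a + \<gamma> + real j * \<gamma>) t))"
    by (auto simp: algebra_simps)
  also have "suminf \<dots> = (- M) * ml_kernel \<gamma> M (a + \<gamma>) t"
    unfolding ml_kernel_def using a \<gamma> by (intro suminf_mult summable_ml) auto
  finally show ?thesis by simp
qed

text \<open>Up to the factor t^(a-1) the kernel is an everywhere convergent power series in
  t^\<gamma>; continuity for t > 0 and the sign near 0 are read off from this form. With t =
  |y|^(1/\<gamma>) the terms are those of \<open>summable_ml_abs\<close>; y = 0 is separate because
  \<open>rl_kernel\<close> is 0 at t = 0.\<close>

lemma summable_ml_powser:
  assumes a: "a > 0"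
  shows "summable (\<lambda>j. (- M) ^ j / Gamma (a + real j * \<gamma>) * y ^ j)"
proof (rule summable_norm_cancel)
  define t where "t = \<bar>y\<bar> powr (1 / \<gamma>)"
  show "summable (\<lambda>j. norm ((- M) ^ j / Gamma (a + real j * \<gamma>) * y ^ j))"
  proof (cases "y = 0")
    case False
    then have t: "t > 0" "t powr \<gamma> = \<bar>y\<bar>" using \<gamma> by (auto simp: t_def powr_powr)
    have eq: "norm ((- M) ^ j / Gamma (a + real j * \<gamma>) * y ^ j) =
      t powr (1 - a) * (M ^ j * rl_kernel (a + real j * \<gamma>) t)" for j
    proof -
      have "t powr (1 - a) * t powr (a + real j * \<gamma> - 1) = \<bar>y\<bar> ^ j"
        using powr_add_nat_mult[OF t(1), of "a - 1" j \<gamma>] t powr_add[of t "1 - a" "a - 1"]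
        by (simp add: algebra_simps)
      then show ?thesis
        using t M Gamma_real_pos[OF ml_order_pos[OF a], of j]
        by (simp add: rl_kernel_def abs_mult power_abs mult_ac)
    qed
    show ?thesis unfolding eq by (rule summable_mult[OF summable_ml_abs[OF a]])
  next
    case True
    then have "(\<lambda>j. norm ((- M) ^ j / Gamma (a + real j * \<gamma>) * y ^ j)) = (\<lambda>j. if j = 0 then \<bar>1 / Gamma a\<bar> else 0)"
      by auto
    then show ?thesis by simp
  qed
qed

lemma ml_kernel_powser:
  assumes a: "a > 0" and t: "t > 0"
  shows "ml_kernel \<gamma> M a t = t powr (a - 1) * (\<Sum>j. (- M) ^ j / Gamma (a + real j * \<gamma>) * (t powr \<gamma>) ^ j)"
    (is "_ = _ * suminf ?f")
proof -
  have eq: "(- M) ^ j * rl_kernel (a + real j * \<gamma>) t = t powr (a - 1) * ?f j" for j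
  proof -
    have "t powr (a + real j * \<gamma> - 1) = t powr (a - 1) * (t powr \<gamma>) ^ j"
      using powr_add_nat_mult[OF t, of "a - 1" j \<gamma>] by (simp add: algebra_simps)
    then show ?thesis using t by (simp add: rl_kernel_def)
  qed
  show ?thesis unfolding ml_kernel_def eq
    by (rule suminf_mult[OF summable_ml_powser[OF a]])
qed

lemma ml_kernel_continuous_on:
  assumes a: "a > 0"
  shows "continuous_on {0<..} (ml_kernel \<gamma> M a)"
proof -
  let ?F = "\<lambda>y. \<Sum>j. (- M) ^ j / Gamma (a + real j * \<gamma>) * y ^ j"
  have F: "continuous_on UNIV ?F"
    by (intro continuous_at_imp_continuous_on ballI isCont_powser_converges_everywhere summable_ml_powser[OF a])
  have "continuous_on {0<..} (\<lambda>t. t powr (a - 1) * ?F (t powr \<gamma>))"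
    by (intro continuous_intros continuous_on_compose2[OF F]) auto
  then show ?thesis
    by (rule continuous_on_eq) (simp add: ml_kernel_powser a)
qed

lemma ml_kernel_pos_near_zero:
  assumes a: "a > 0"
  shows "\<forall>\<^sub>F t in at_right 0. ml_kernel \<gamma> M a t > 0"
proof -
  let ?F = "\<lambda>y. \<Sum>j. (- M) ^ j / Gamma (a + real j * \<gamma>) * y ^ j"
  have F: "isCont ?F 0"
    by (rule isCont_powser_converges_everywhere[OF summable_ml_powser[OF a]])
  have F0: "?F 0 = 1 / Gamma a" by (subst powser_zero) simp
  have "((\<lambda>t. t powr \<gamma>) \<longlongrightarrow> 0 powr \<gamma>) (at_right 0)"
    by (rule tendsto_powr2[OF tendsto_ident_at tendsto_const _ \<gamma>])
       (rule eventually_mono[OF eventually_at_right_less], simp)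
  then have "((\<lambda>t. ?F (t powr \<gamma>)) \<longlongrightarrow> 1 / Gamma a) (at_right 0)"
    using isCont_tendsto_compose[OF F, of "\<lambda>t. t powr \<gamma>"] unfolding F0 by simp
  then have "\<forall>\<^sub>F t in at_right 0. ?F (t powr \<gamma>) > 0"
    by (rule order_tendstoD(1)) (simp add: a)
  then show ?thesis
    using eventually_at_right_less[of 0]
    by eventually_elim (simp add: ml_kernel_powser a)
qed

end

section \<open>Sign, decay and integrability of the kernels for orders below one\<close>

lemma integral_rl_kernel_atMost: "a > 0 \<Longrightarrow> (\<integral>s. indicator {..T} s * rl_kernel a s \<partial>lborel) = rl_kernel (a + 1) T"
  by (simp add: integral_atMost_eq_kconv rl_kernel_loc_int kconv_rl_kernel add.commute)

lemma rl_kernel_antimono: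
  assumes "0 < a" "a \<le> 1" "0 < s" "s \<le> t"
  shows "rl_kernel a t \<le> rl_kernel a s"
  using assms by (simp add: rl_kernel_def divide_right_mono powr_mono2')

text \<open>Monotone convergence along truncations at natural numbers: nonnegativity and a bound on
  the primitive take the place of a dominating function.\<close>

lemma integrable_if_bounded_truncations:
  assumes K: "loc_int K" and nonneg: "\<And>t. K t \<ge> 0"
    and bound: "\<And>T. (\<integral>t. indicator {..T} t * K t \<partial>lborel) \<le> C"
  shows "integrable lborel K"
proof -
  let ?f = "\<lambda>(n::nat) t. indicator {..real n} t * K t"
  note [measurable] = loc_int_measurable[OF K]
  have "incseq (\<lambda>n. integral\<^sup>L lborel (?f n))"
    using nonneg by (intro incseq_SucI integral_mono loc_int_integrable[OF K]) (auto split: split_indicator)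
  moreover have "\<forall>n. integral\<^sup>L lborel (?f n) \<le> C" using bound by simp
  ultimately obtain l where "(\<lambda>n. integral\<^sup>L lborel (?f n)) \<longlonglongrightarrow> l"
    by (rule incseq_convergent)
  then show ?thesis
  proof (rule integrable_monotone_convergence[rotated 3])
    show "AE x in lborel. mono (\<lambda>n. ?f n x)"
      using nonneg by (intro AE_I2 monoI) (auto split: split_indicator)
    show "AE x in lborel. (\<lambda>n. ?f n x) \<longlonglongrightarrow> K x"
    proof (rule AE_I2)
      fix x
      obtain N :: nat where "x \<le> real N" using real_arch_simple by blast
      then have "\<forall>\<^sub>F n in sequentially. ?f n x = K x"
        by (intro eventually_sequentiallyI[of N]) (auto split: split_indicator)
      then show "(\<lambda>n. ?f n x) \<longlonglongrightarrow> K x" by (rule tendsto_eventually)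
    qed
  qed (use loc_int_integrable[OF K] in simp_all)
qed

context
  fixes \<gamma> M :: real
  assumes \<gamma>: "0 < \<gamma>" "\<gamma> < 1" and M: "M > 0"
begin

text \<open>\<open>e\<close> has the Laplace transform 1 / (s^\<gamma> + M), and \<open>E\<close> is
  E_\<gamma>(-M t^\<gamma>) for t > 0. They are linked by E' = -M e, used below in the integrated
  form \<open>ml_one_eq\<close>.\<close>

private abbreviation "e \<equiv> ml_kernel \<gamma> M \<gamma>"
private abbreviation "k \<equiv> rl_kernel \<gamma>"
private abbreviation "E \<equiv> ml_kernel \<gamma> M 1"

lemma ml_resolvent: "e t = k t - M * kconv k e t"
  using ml_kernel_recurrence[of \<gamma> M \<gamma> t] kconv_rl_ml_kernel[of \<gamma> M \<gamma> \<gamma> t] \<gamma> M by simp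

text \<open>At a first zero \<open>t0\<close> of the resolvent, log-convexity of the kernel gives
  $k(t_0-s)/k(t-s) \le k(t_0)/k(t)$ for $t < t_0$, so the Volterra equation at \<open>t0\<close> can be compared
  with the one at \<open>t\<close>. Taking \<open>t\<close> close to \<open>t0\<close> and maximal for the resolvent on the remaining
  interval yields a contradiction.\<close>

lemma ml_resolvent_pos:
  assumes "t > 0"
  shows "e t > 0"
proof (rule ccontr)
  assume "\<not> e t > 0"
  obtain b where b: "b > 0" "\<And>s. 0 < s \<Longrightarrow> s < b \<Longrightarrow> e s > 0"
    using ml_kernel_pos_near_zero[OF \<gamma>(1) M \<gamma>(1)] by (auto simp: eventually_at_right_field)
  define S where "S = {s \<in> {b..}. e s \<le> 0}"
  have cont: "continuous_on {0<..} e" by (rule ml_kernel_continuous_on[OF \<gamma>(1) M \<gamma>(1)])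
  have "closed S" unfolding S_def
    using b by (intro continuous_on_closed_Collect_le continuous_on_subset[OF cont]) auto
  moreover have "t \<in> S" using \<open>\<not> e t > 0\<close> assms b(2)[of t] by (cases "t < b") (auto simp: S_def)
  moreover have bdd: "bdd_below S" by (auto simp: S_def bdd_below_def)
  ultimately have "Inf S \<in> S" by (intro closed_contains_Inf) auto
  define t0 where "t0 = Inf S"
  have t0: "t0 > 0" "e t0 \<le> 0" using \<open>Inf S \<in> S\<close> b by (auto simp: t0_def S_def)
  have pos: "e s > 0" if "0 < s" "s < t0" for s
    using cInf_lower[OF _ bdd, of s] b(2)[of s] that by (force simp: t0_def S_def)
  \<comment> \<open>This makes M h^\<gamma> / Gamma (\<gamma> + 1) equal to 1/4, which will
    contradict c \<ge> 1/2.\<close>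
  define h where "h = (Gamma (\<gamma> + 1) / (4 * M)) powr (1 / \<gamma>)"
  have G: "Gamma (\<gamma> + 1) > 0" using \<gamma> by simp
  then have h: "h > 0" "h powr \<gamma> = Gamma (\<gamma> + 1) / (4 * M)"
    using M \<gamma> less_imp_neq[OF G] by (auto simp: h_def powr_powr)
  \<comment> \<open>The bound t0 / 2 gives c \<ge> 1/2, and t0 - h keeps the window short. The
    maximum over the window is not attained at t0, since \<open>e\<close> is positive at t1.\<close>
  define t1 where "t1 = max (t0 / 2) (t0 - h)"
  have t1: "0 < t1" "t1 < t0" "t0 / 2 \<le> t1" "t0 - t1 \<le> h" using t0 h by (auto simp: t1_def)
  obtain t where t: "t \<in> {t1..t0}" and max: "\<And>s. s \<in> {t1..t0} \<Longrightarrow> e s \<le> e t"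
  proof -
    have "continuous_on {t1..t0} e" by (rule continuous_on_subset[OF cont]) (use t1 in auto)
    then show ?thesis
      using continuous_attains_sup[of "{t1..t0}" e] t1 that by fastforce
  qed
  have et: "e t > 0" using max[of t1] pos[of t1] t1 by auto
  then have tt0: "t < t0" "t > 0" using t t0 t1 by (cases "t = t0"; auto)+
  have kt: "k t > 0" "k t0 > 0" using rl_kernel_pos[OF \<gamma>(1)] tt0 t0 by auto
  define c where "c = k t0 / k t"
  have c: "c \<ge> 1 / 2"
  proof -
    have "c = (t / t0) powr (1 - \<gamma>)"
      using tt0 t0 less_imp_neq[OF Gamma_real_pos[OF \<gamma>(1)]]
      by (simp add: c_def rl_kernel_def powr_divide powr_diff)
    moreover have "(1 / 2) powr 1 \<le> (1 / 2) powr (1 - \<gamma> :: real)" using \<gamma> by (intro powr_mono') auto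
    moreover have "(1 / 2) powr (1 - \<gamma>) \<le> (t / t0) powr (1 - \<gamma>)"
      using \<gamma> t t1 t0 by (intro powr_mono2) (auto simp: field_simps)
    ultimately show ?thesis by simp
  qed
  have K: "loc_int k" using \<gamma> by (simp add: rl_kernel_loc_int)
  have trunc: "(\<integral>s. indicator {..t0 - t} (t0 - s) * k (t0 - s) \<partial>lborel) = rl_kernel (\<gamma> + 1) (t0 - t)"
    using loc_int_reflect_integral[of "t0 - t" t0 k] integral_rl_kernel_atMost[OF \<gamma>(1), of "t0 - t"] rl_kernel_nonneg[OF \<gamma>(1)]
    by simp
  have int: "integrable lborel (\<lambda>s. k (u - s) * e s)" for u
    by (rule ml_kernel_prod_integrable) (use \<gamma> M in auto)
  have int': "integrable lborel (\<lambda>s. indicator {..t0 - t} (t0 - s) * k (t0 - s))"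
    using loc_int_reflect_integrable[OF K, of "t0 - t" t0] rl_kernel_nonneg[OF \<gamma>(1)] by simp
  \<comment> \<open>On (0, t) log-convexity replaces k (t0 - s) by c k (t - s); on [t, t0]
    maximality replaces e s by e t, leaving the mass of k over a window of length t0 - t.\<close>
  have "kconv k e t0 \<le> (\<integral>s. c * (k (t - s) * e s) + e t * (indicator {..t0 - t} (t0 - s) * k (t0 - s)) \<partial>lborel)"
    unfolding kconv_def real_scaleR_def
  proof (rule integral_mono)
    show "integrable lborel (\<lambda>s. c * (k (t - s) * e s) + e t * (indicator {..t0 - t} (t0 - s) * k (t0 - s)))"
      by (intro Bochner_Integration.integrable_add integrable_mult_right int int')
    fix s
    have nn: "k u \<ge> 0" for u by (rule rl_kernel_nonneg[OF \<gamma>(1)])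
    consider "s \<le> 0" | "0 < s" "s < t" | "t \<le> s" "s \<le> t0" | "t0 < s" by linarith
    then show "k (t0 - s) * e s \<le> c * (k (t - s) * e s) + e t * (indicator {..t0 - t} (t0 - s) * k (t0 - s))"
    proof cases
      case 1
      then show ?thesis using et nn[of "t0 - s"] ml_kernel_nonpos_arg[OF \<gamma>(1) M, of s]
        by (auto split: split_indicator)
    next
      case 2
      have "k (t0 - s) \<le> c * k (t - s)"
      proof -
        have "t0 / t \<le> (t0 - s) / (t - s)" using 2 tt0 by (simp add: field_simps)
        then have "((t0 - s) / (t - s)) powr (\<gamma> - 1) \<le> (t0 / t) powr (\<gamma> - 1)"
          using \<gamma> t0 tt0 by (intro powr_mono2') auto
        then have "(t0 - s) powr (\<gamma> - 1) \<le> (t0 powr (\<gamma> - 1) / t powr (\<gamma> - 1)) * (t - s) powr (\<gamma> - 1)"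
          using 2 tt0 t0 by (simp add: powr_divide field_simps)
        from divide_right_mono[OF this, of "Gamma \<gamma>"] show ?thesis
          using 2 tt0 t0 \<gamma> less_imp_neq[OF Gamma_real_pos[OF \<gamma>(1)]]
          by (simp add: rl_kernel_def c_def)
      qed
      then have "k (t0 - s) * e s \<le> c * k (t - s) * e s"
        using pos[of s] 2 tt0 by (intro mult_right_mono) auto
      then show ?thesis using 2 by (simp add: mult.assoc)
    next
      case 3
      then have "k (t0 - s) * e s \<le> k (t0 - s) * e t"
        using max[of s] t nn by (intro mult_left_mono) auto
      then show ?thesis using 3 by (simp add: rl_kernel_def[of _ "t - s"] mult.commute)
    next
      case 4
      then show ?thesis using tt0 by (simp add: rl_kernel_def)
    qed
  qed (rule int)
  also have "\<dots> = c * kconv k e t + e t * rl_kernel (\<gamma> + 1) (t0 - t)"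
    using int[of t] int' trunc by (simp add: kconv_def)
  finally have "kconv k e t0 \<le> c * kconv k e t + e t * rl_kernel (\<gamma> + 1) (t0 - t)" .
  from mult_left_mono[OF this less_imp_le[OF M]]
  have "M * kconv k e t0 \<le> c * (M * kconv k e t) + e t * (M * rl_kernel (\<gamma> + 1) (t0 - t))"
    by (simp add: algebra_simps)
  \<comment> \<open>The resolvent equation gives M (k * e)(t) = k t - e t, and M (k * e)(t0) \<ge> k
    t0 because e t0 \<le> 0. As c k t = k t0, the kernel values cancel and only multiples of e t
    survive.\<close>
  then have "k t0 \<le> c * (k t - e t) + e t * (M * rl_kernel (\<gamma> + 1) (t0 - t))"
    using ml_resolvent[of t] ml_resolvent[of t0] t0 by simp
  moreover have "c * k t = k t0" using kt by (simp add: c_def)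
  ultimately have "e t * c \<le> e t * (M * rl_kernel (\<gamma> + 1) (t0 - t))" by (simp add: algebra_simps)
  then have "c \<le> M * rl_kernel (\<gamma> + 1) (t0 - t)" using et by simp
  also have "\<dots> \<le> M * (h powr \<gamma> / Gamma (\<gamma> + 1))"
    using tt0 t t1 \<gamma> M by (auto simp: rl_kernel_def intro!: divide_right_mono powr_mono2)
  also have "\<dots> = 1 / 4" using M less_imp_neq[OF G] by (simp add: h(2))
  finally show False using c by simp
qed

lemma ml_resolvent_nonneg: "e t \<ge> 0"
  using ml_resolvent_pos[of t] ml_kernel_nonpos_arg[OF \<gamma>(1) M, of t \<gamma>] by (cases "t > 0") auto

lemma ml_resolvent_loc_int: "loc_int e"
  by (rule ml_kernel_loc_int[OF \<gamma>(1) M \<gamma>(1)])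

lemma ml_one_eq: "t > 0 \<Longrightarrow> E t = 1 - M * (\<integral>s. indicator {..t} s * e s \<partial>lborel)"
  using ml_kernel_recurrence[OF \<gamma>(1) M, of 1 t] kconv_rl_ml_kernel[OF \<gamma>(1) M \<gamma>(1), of 1 t]
  by (simp add: integral_atMost_eq_kconv[OF ml_resolvent_loc_int] rl_kernel_one add.commute)

text \<open>\<open>E\<close> is the fractional integral of order 1 - \<gamma> of the nonnegative
  kernel \<open>e\<close>; this order is positive because \<gamma> < 1.\<close>

lemma ml_one_nonneg: "E t \<ge> 0"
proof -
  have "E t = kconv (rl_kernel (1 - \<gamma>)) e t"
    using kconv_rl_ml_kernel[OF \<gamma>(1) M \<gamma>(1), of "1 - \<gamma>" t] \<gamma> by simp
  also have "\<dots> \<ge> 0" unfolding kconv_def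
    using \<gamma> rl_kernel_nonneg[of "1 - \<gamma>"] ml_resolvent_nonneg by (intro integral_nonneg_AE) auto
  finally show ?thesis .
qed

lemma ml_one_antimono:
  assumes "0 < s" "s \<le> t"
  shows "E t \<le> E s"
proof -
  have "(\<integral>u. indicator {..s} u * e u \<partial>lborel) \<le> (\<integral>u. indicator {..t} u * e u \<partial>lborel)"
    using assms ml_resolvent_nonneg
    by (intro integral_mono loc_int_integrable[OF ml_resolvent_loc_int]) (auto split: split_indicator)
  then show ?thesis using assms M by (simp add: ml_one_eq)
qed

lemma ml_one_le_1: "E t \<le> 1"
proof (cases "t > 0")
  case True
  have "(\<integral>s. indicator {..t} s * e s \<partial>lborel) \<ge> 0"
    using ml_resolvent_nonneg by (intro integral_nonneg_AE) auto
  then show ?thesis using M by (simp add: ml_one_eq True)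
qed (simp add: ml_kernel_nonpos_arg[OF \<gamma>(1) M])

text \<open>As \<open>E\<close> decreases, E t times the integral of k over (0, t), which is
  t^\<gamma> / Gamma (\<gamma> + 1), is at most (k * E)(t) = (1 - E t) / M \<le> 1 / M.\<close>

lemma ml_one_decay:
  assumes t: "t > 0"
  shows "E t \<le> Gamma (\<gamma> + 1) / M * t powr - \<gamma>"
proof -
  have K: "loc_int k" using \<gamma> by (simp add: rl_kernel_loc_int)
  have int: "integrable lborel (\<lambda>s. indicator {..t} (t - s) * k (t - s))"
    using loc_int_reflect_integrable[OF K, of t t] rl_kernel_nonneg[OF \<gamma>(1)] by simp
  have "E t * rl_kernel (\<gamma> + 1) t = (\<integral>s. E t * (indicator {..t} (t - s) * k (t - s)) \<partial>lborel)"
    using loc_int_reflect_integral[of t t k] integral_rl_kernel_atMost[OF \<gamma>(1), of t] rl_kernel_nonneg[OF \<gamma>(1)]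
    by simp
  also have "\<dots> \<le> (\<integral>s. k (t - s) * E s \<partial>lborel)"
  proof (rule integral_mono_AE)
    show "integrable lborel (\<lambda>s. E t * (indicator {..t} (t - s) * k (t - s)))"
      by (rule integrable_mult_right[OF int])
    show "integrable lborel (\<lambda>s. k (t - s) * E s)"
      by (rule ml_kernel_prod_integrable) (use \<gamma> M in auto)
    \<comment> \<open>At s = 0 the inequality may fail, because the series gives \<open>E\<close>
      the value 0 there and not its right limit 1.\<close>
    show "AE s in lborel. E t * (indicator {..t} (t - s) * k (t - s)) \<le> k (t - s) * E s"
      using AE_lborel_singleton[of 0]
    proof eventually_elim
      case (elim s)
      then consider "s < 0" | "0 < s" "s \<le> t" | "s > t" by linarith
      then show ?case
      proof cases
        case 1
        then show ?thesis using t ml_kernel_nonpos_arg[OF \<gamma>(1) M, of s] by (auto split: split_indicator)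
      next
        case 2
        then show ?thesis using mult_right_mono[OF ml_one_antimono[OF 2] rl_kernel_nonneg[OF \<gamma>(1), of "t - s"]]
          by (simp add: mult.commute)
      next
        case 3
        then show ?thesis by (simp add: rl_kernel_def)
      qed
    qed
  qed
  also have "\<dots> = (1 - E t) / M"
    using ml_kernel_recurrence[OF \<gamma>(1) M, of 1 t] kconv_rl_ml_kernel[OF \<gamma>(1) M, of 1 \<gamma> t] \<gamma> t M
    by (simp add: kconv_def rl_kernel_one)
  also have "\<dots> \<le> 1 / M" using M ml_one_nonneg[of t] by (simp add: divide_right_mono)
  finally have "E t * (t powr \<gamma> / Gamma (\<gamma> + 1)) \<le> 1 / M" using t by (simp add: rl_kernel_def)
  moreover have "Gamma (\<gamma> + 1) > 0" using \<gamma> by simp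
  ultimately show ?thesis using t M by (simp add: powr_minus field_simps)
qed

lemma ml_one_tendsto: "(E \<longlongrightarrow> 0) at_top"
proof (rule tendsto_sandwich[OF _ _ tendsto_const])
  show "\<forall>\<^sub>F t in at_top. 0 \<le> E t" using ml_one_nonneg by simp
  show "\<forall>\<^sub>F t in at_top. E t \<le> Gamma (\<gamma> + 1) / M * t powr - \<gamma>"
    using eventually_gt_at_top[of 0] by eventually_elim (rule ml_one_decay)
  have "((\<lambda>t. t powr - \<gamma>) \<longlongrightarrow> 0) at_top"
    using \<gamma> by (intro tendsto_neg_powr filterlim_ident) auto
  then show "((\<lambda>t. Gamma (\<gamma> + 1) / M * t powr - \<gamma>) \<longlongrightarrow> 0) at_top"
    by (rule tendsto_mult_right_zero)
qed

text \<open>By \<open>ml_one_eq\<close> the primitive of \<open>e\<close> is (1 - E) / M, which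
  tends to 1 / M; monotone convergence applies since \<open>e\<close> is nonnegative.\<close>

lemma
  shows ml_resolvent_integrable: "integrable lborel e"
    and integral_ml_resolvent: "integral\<^sup>L lborel e = 1 / M"
proof -
  have "((\<lambda>t. (1 - E t) / M) \<longlongrightarrow> (1 - 0) / M) at_top"
    using M by (intro tendsto_intros ml_one_tendsto) auto
  then have "((\<lambda>t. (1 - E t) / M) \<longlongrightarrow> 1 / M) at_top" by simp
  then have "((\<lambda>t. \<integral>s. e s * indicator {..t} s \<partial>lborel) \<longlongrightarrow> 1 / M) at_top"
  proof (rule Lim_transform_eventually)
    show "\<forall>\<^sub>F t in at_top. (1 - E t) / M = (\<integral>s. e s * indicator {..t} s \<partial>lborel)"
      using eventually_gt_at_top[of 0] by eventually_elim (use M in \<open>simp add: ml_one_eq mult.commute\<close>)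
  qed
  note * = this loc_int_integrable[OF ml_resolvent_loc_int] loc_int_measurable[OF ml_resolvent_loc_int] ml_resolvent_nonneg
  show "integrable lborel e"
    by (rule integrable_monotone_convergence_at_top[OF _ _ _ _ *(1)]) (use *(2-) in \<open>auto simp: mult.commute\<close>)
  show "integral\<^sup>L lborel e = 1 / M"
    by (rule integral_monotone_convergence_at_top[OF _ _ _ _ *(1)]) (use *(2-) in \<open>auto simp: mult.commute\<close>)
qed

text \<open>The kernel \<open>u = ml_kernel \<gamma> M \<sigma>\<close> changes sign, but $k_\sigma E - u \ge 0$ because $k_\sigma$
  decreases, while $k_\sigma E$ is integrable and the primitive of \<open>u\<close>, being $k_\sigma * E$, is nonnegative.\<close>

lemma ml_kernel_integrable:
  assumes \<sigma>: "0 < \<sigma>" "\<sigma> \<le> \<gamma>"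
  shows "integrable lborel (ml_kernel \<gamma> M \<sigma>)"
proof (cases "\<sigma> = \<gamma>")
  case True
  then show ?thesis using ml_resolvent_integrable by simp
next
  case False
  then have \<sigma>': "\<sigma> < \<gamma>" "\<sigma> < 1" using \<sigma> \<gamma> by auto
  let ?u = "ml_kernel \<gamma> M \<sigma>" and ?k = "rl_kernel \<sigma>"
  note [measurable] = ml_kernel_measurable[OF \<gamma>(1) M]
  \<comment> \<open>Up to 1 the bound E \<le> 1 leaves the integrable singularity of
    \<open>rl_kernel \<sigma>\<close>; beyond 1 the decay of \<open>E\<close> gives the power
    \<sigma> - \<gamma> - 1, which is integrable since \<sigma> < \<gamma>.\<close>
  have kE: "integrable lborel (\<lambda>t. ?k t * E t)"
  proof (rule Bochner_Integration.integrable_bound)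
    define c where "c = Gamma (\<gamma> + 1) / M / Gamma \<sigma>"
    have c: "c \<ge> 0" using \<gamma> \<sigma> M by (simp add: c_def)
    have "(\<lambda>t::real. t powr (\<sigma> - \<gamma> - 1)) absolutely_integrable_on {1..}"
      using has_integral_powr_to_inf[of "\<sigma> - \<gamma> - 1" 1] \<sigma>'
      by (intro nonnegative_absolutely_integrable_1) (auto simp: integrable_on_def)
    then have "integrable lborel (\<lambda>t::real. indicator {1..} t *\<^sub>R t powr (\<sigma> - \<gamma> - 1))"
      unfolding set_integrable_def by (subst (asm) integrable_completion) auto
    then show "integrable lborel (\<lambda>t. indicator {..1} t * ?k t + c * (indicator {1..} t *\<^sub>R t powr (\<sigma> - \<gamma> - 1)))"
      by (intro Bochner_Integration.integrable_add integrable_mult_right loc_int_integrable rl_kernel_loc_int \<sigma>)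
    show "AE t in lborel. norm (?k t * E t) \<le> norm (indicator {..1} t * ?k t + c * (indicator {1..} t *\<^sub>R t powr (\<sigma> - \<gamma> - 1)))"
    proof (rule AE_I2)
      fix t
      have kn: "?k t \<ge> 0" by (rule rl_kernel_nonneg[OF \<sigma>(1)])
      have "?k t * E t \<le> indicator {..1} t * ?k t + c * (indicator {1..} t *\<^sub>R t powr (\<sigma> - \<gamma> - 1))"
      proof (cases "t \<le> 1")
        case True
        then show ?thesis
          using mult_left_mono[OF ml_one_le_1[of t] kn] c by (simp add: add_increasing2)
      next
        case False
        then have "?k t * E t \<le> ?k t * (Gamma (\<gamma> + 1) / M * t powr - \<gamma>)"
          by (intro mult_left_mono ml_one_decay kn) auto
        also have "\<dots> = c * t powr (\<sigma> - \<gamma> - 1)"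
        proof -
          have "t powr (\<sigma> - \<gamma> - 1) = t powr (\<sigma> - 1) * t powr - \<gamma>"
            using powr_add[of t "\<sigma> - 1" "- \<gamma>"] by (simp add: algebra_simps)
          then show ?thesis using False by (simp add: rl_kernel_def c_def mult_ac)
        qed
        finally show ?thesis using False by simp
      qed
      then show "norm (?k t * E t) \<le> norm (indicator {..1} t * ?k t + c * (indicator {1..} t *\<^sub>R t powr (\<sigma> - \<gamma> - 1)))"
        using kn ml_one_nonneg[of t] by (simp add: abs_mult)
    qed
  qed measurable
  define v where "v t = ?k t * E t - ?u t" for t
  have u: "loc_int ?u" by (rule ml_kernel_loc_int[OF \<gamma>(1) M \<sigma>(1)])
  have kE': "integrable lborel (\<lambda>t. indicator {..T} t * (?k t * E t))" for T
    using integrable_mult_indicator[OF _ kE, of "{..T}"] by simp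
  have v_loc: "loc_int v"
  proof -
    have "integrable lborel (\<lambda>t. indicator {..T} t * (?k t * E t) - indicator {..T} t * ?u t)" for T
      by (intro Bochner_Integration.integrable_diff loc_int_integrable u kE')
    then show ?thesis
      by (auto simp: loc_int_def v_def[abs_def] algebra_simps ml_kernel_nonpos_arg[OF \<gamma>(1) M])
  qed
  \<comment> \<open>The recurrence and \<open>ml_one_eq\<close> give, for t > 0, that v t is M times
    the integral of (k_\<sigma>(t - s) - k_\<sigma>(t)) e s over 0 < s < t.\<close>
  have v_nonneg: "v t \<ge> 0" for t
  proof (cases "t > 0")
    case True
    have "(\<integral>s. ?k t * (indicator {..t} s * e s) \<partial>lborel) \<le> (\<integral>s. ?k (t - s) * e s \<partial>lborel)"
    proof (rule integral_mono_AE)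
      show "integrable lborel (\<lambda>s. ?k t * (indicator {..t} s * e s))"
        by (intro integrable_mult_right loc_int_integrable ml_resolvent_loc_int)
      show "integrable lborel (\<lambda>s. ?k (t - s) * e s)"
        by (rule ml_kernel_prod_integrable) (use \<gamma> M \<sigma> in auto)
      show "AE s in lborel. ?k t * (indicator {..t} s * e s) \<le> ?k (t - s) * e s"
        using AE_lborel_singleton[of t]
      proof eventually_elim
        case (elim s)
        then consider "s \<le> 0" | "0 < s" "s < t" | "s > t" by linarith
        then show ?case
        proof cases
          case 1
          then show ?thesis by (simp add: ml_kernel_nonpos_arg[OF \<gamma>(1) M])
        next
          case 2
          then show ?thesis
            using rl_kernel_antimono[of \<sigma> "t - s" t] \<sigma> \<sigma>' ml_resolvent_nonneg[of s]
            by (auto intro!: mult_right_mono)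
        next
          case 3
          then show ?thesis by (simp add: rl_kernel_def)
        qed
      qed
    qed
    then have "?k t * (\<integral>s. indicator {..t} s * e s \<partial>lborel) \<le> ml_kernel \<gamma> M (\<sigma> + \<gamma>) t"
      using kconv_rl_ml_kernel[OF \<gamma>(1) M \<gamma>(1) \<sigma>(1), of t] by (simp add: kconv_def add.commute)
    from mult_left_mono[OF this, of M] show ?thesis
      using M by (simp add: v_def ml_kernel_recurrence[OF \<gamma>(1) M \<sigma>(1), of t] ml_one_eq[OF True] algebra_simps)
  qed (simp add: v_def ml_kernel_nonpos_arg[OF \<gamma>(1) M])
  have "(\<integral>t. indicator {..T} t * v t \<partial>lborel) \<le> (\<integral>t. ?k t * E t \<partial>lborel)" for T
  proof -
    have "(\<integral>t. indicator {..T} t * v t \<partial>lborel) =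
        (\<integral>t. indicator {..T} t * (?k t * E t) \<partial>lborel) - (\<integral>t. indicator {..T} t * ?u t \<partial>lborel)"
      unfolding v_def right_diff_distrib
      by (intro Bochner_Integration.integral_diff loc_int_integrable u kE')
    also have "(\<integral>t. indicator {..T} t * ?u t \<partial>lborel) = ml_kernel \<gamma> M (1 + \<sigma>) T"
      using kconv_rl_ml_kernel[OF \<gamma>(1) M \<sigma>(1), of 1 T]
      by (simp add: integral_atMost_eq_kconv[OF u] add.commute)
    also have "\<dots> = kconv ?k E T"
      using kconv_rl_ml_kernel[OF \<gamma>(1) M, of 1 \<sigma> T] \<sigma> by simp
    finally have "(\<integral>t. indicator {..T} t * v t \<partial>lborel) =
        (\<integral>t. indicator {..T} t * (?k t * E t) \<partial>lborel) - kconv ?k E T" .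
    moreover have "kconv ?k E T \<ge> 0" unfolding kconv_def
      using rl_kernel_nonneg[OF \<sigma>(1)] ml_one_nonneg by (intro integral_nonneg_AE) auto
    moreover have "(\<integral>t. indicator {..T} t * (?k t * E t) \<partial>lborel) \<le> (\<integral>t. ?k t * E t \<partial>lborel)"
      using rl_kernel_nonneg[OF \<sigma>(1)] ml_one_nonneg
      by (intro integral_mono kE kE') (auto split: split_indicator)
    ultimately show ?thesis by linarith
  qed
  then have "integrable lborel v" by (rule integrable_if_bounded_truncations[OF v_loc v_nonneg])
  from Bochner_Integration.integrable_diff[OF kE this] show ?thesis by (simp add: v_def)
qed

end

section \<open>Scalar Volterra equations\<close>

lemma loc_bdd_tendsto_bounded:
  assumes f: "loc_bdd f" and lim: "(f \<longlongrightarrow> l) at_top"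
  obtains B where "B \<ge> 0" "\<And>t. norm (f t) \<le> B"
proof -
  have "\<forall>\<^sub>F t in at_top. dist (f t) l < 1" using tendstoD[OF lim, of 1] by simp
  then obtain T where T: "\<And>t. t \<ge> T \<Longrightarrow> dist (f t) l < 1" by (auto simp: eventually_at_top_linorder)
  obtain B where B: "B \<ge> 0" "\<And>t. t \<le> T \<Longrightarrow> norm (f t) \<le> B" by (rule loc_bddE[OF f, of T]) blast
  have "norm (f t) \<le> max B (norm l + 1)" for t
  proof (cases "t \<le> T")
    case False
    then have "norm (f t) \<le> norm l + 1"
      using T[of t] norm_triangle_sub[of "f t" l] by (simp add: dist_norm)
    then show ?thesis by simp
  qed (use B(2)[of t] in simp)
  then show ?thesis using B(1) by (intro that[of "max B (norm l + 1)"]) auto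
qed

text \<open>Absorption: the supremum S of |w| over {..t} is finite and satisfies S \<le> q S + H
  with q < 1. The resulting bound no longer depends on t.\<close>

lemma volterra_bounded:
  fixes w h :: "real \<Rightarrow> complex"
  assumes e: "loc_int e" "integrable lborel e" "\<And>t. e t \<ge> 0"
    and \<kappa>: "norm \<kappa> * integral\<^sup>L lborel e < 1"
    and w: "loc_bdd w" and h: "\<And>t. norm (h t) \<le> H"
    and eq: "\<And>t. w t = \<kappa> * kconv e w t + h t"
  shows "norm (w t) \<le> H / (1 - norm \<kappa> * integral\<^sup>L lborel e)"
proof -
  define q where "q = norm \<kappa> * integral\<^sup>L lborel e"
  define S where "S = (SUP s\<in>{..t}. norm (w s))"
  obtain B where B: "B \<ge> 0" "\<And>s. s \<le> t \<Longrightarrow> norm (w s) \<le> B" by (rule loc_bddE[OF w, of t]) blast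
  have S: "norm (w s) \<le> S" if "s \<le> t" for s
    unfolding S_def using that B by (intro cSUP_upper) (auto simp: bdd_above_def)
  have S0: "S \<ge> 0" using S[of t] norm_ge_zero[of "w t"] by linarith
  have trunc: "(\<integral>s. indicator {..t} s * \<bar>e s\<bar> \<partial>lborel) \<le> integral\<^sup>L lborel e"
    using e(3) loc_int_norm_integrable[OF e(1)]
    by (intro integral_mono e(2)) (auto split: split_indicator)
  have "norm (w s) \<le> q * S + H" if "s \<le> t" for s
  proof -
    have *: "norm (w s) \<le> norm \<kappa> * norm (kconv e w s) + norm (h s)"
      by (subst eq) (metis norm_mult norm_triangle_ineq)
    moreover have "norm (kconv e w s) \<le> S * (\<integral>s. indicator {..t} s * \<bar>e s\<bar> \<partial>lborel)"
      by (rule kconv_norm_le[OF e(1) w S that])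
    moreover have "\<dots> \<le> S * integral\<^sup>L lborel e" by (rule mult_left_mono[OF trunc S0])
    ultimately have "norm (kconv e w s) \<le> S * integral\<^sup>L lborel e" by linarith
    from mult_left_mono[OF this norm_ge_zero[of \<kappa>]]
    have "norm \<kappa> * norm (kconv e w s) \<le> q * S" by (simp add: q_def mult_ac)
    with * h[of s] show ?thesis by linarith
  qed
  then have "S \<le> q * S + H" unfolding S_def by (intro cSUP_least) auto
  then have "(1 - q) * S \<le> H" by (simp add: algebra_simps)
  then have "S \<le> H / (1 - q)" using \<kappa> by (simp add: q_def field_simps)
  then show ?thesis using S[of t] by (simp add: q_def)
qed

text \<open>The candidate limit solves l = \<open>h\<^sub>0\<close> + \<kappa> J l. The difference v
  = w - l satisfies the same equation with forcing tending to 0, and each eventual bound b for |v|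
  improves to r b: convolution with \<open>e\<close> eventually forgets everything before the time
  from which b holds.\<close>

lemma volterra_contraction_converges:
  fixes w h :: "real \<Rightarrow> complex"
  assumes e: "loc_int e" "integrable lborel e" "\<And>t. e t \<ge> 0"
    and \<kappa>: "norm \<kappa> * integral\<^sup>L lborel e < 1"
    and w: "loc_bdd w" and h: "loc_bdd h" "(h \<longlongrightarrow> h\<^sub>0) at_top"
    and eq: "\<And>t. w t = \<kappa> * kconv e w t + h t"
  shows "\<exists>l. (w \<longlongrightarrow> l) at_top"
proof -
  define J where "J = integral\<^sup>L lborel e"
  define q where "q = norm \<kappa> * J"
  \<comment> \<open>Any number strictly between q and 1 would do; the gap r - q absorbs the forcing
    and the error in the limit of the convolution, half of it each.\<close>
  define r where "r = (1 + q) / 2"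
  have J: "J \<ge> 0" unfolding J_def using e(3) by simp
  have q: "0 \<le> q" "q < 1" using \<kappa> J by (auto simp: q_def J_def)
  have r: "q < r" "r < 1" "0 < r" using q by (auto simp: r_def)
  note [measurable] = loc_int_measurable[OF e(1)] loc_bdd_measurable[OF w]
  obtain H where "H \<ge> 0" "\<And>t. norm (h t) \<le> H" using loc_bdd_tendsto_bounded[OF h] by blast
  then obtain B where B: "\<And>t. norm (w t) \<le> B"
    using volterra_bounded[OF e \<kappa> w _ eq] by blast
  have ne: "1 - \<kappa> * of_real J \<noteq> 0"
  proof
    assume "1 - \<kappa> * of_real J = 0"
    then have "norm (\<kappa> * of_real J) = 1" by (metis eq_iff_diff_eq_0 norm_one)
    then show False using q J by (simp add: q_def norm_mult)
  qed
  define l where "l = h\<^sub>0 / (1 - \<kappa> * of_real J)"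
  have l: "l = h\<^sub>0 + \<kappa> * of_real J * l" using ne by (simp add: l_def field_simps)
  define v where "v t = w t - l" for t
  define C where "C = B + norm l + 1"
  have C: "C > 0" using B[of 0] norm_ge_zero[of "w 0"] norm_ge_zero[of l] unfolding C_def by linarith
  have vC: "norm (v t) \<le> C" for t
    using B[of t] norm_triangle_ineq4[of "w t" l] by (simp add: v_def C_def)
  have int: "integrable lborel (\<lambda>s. e s *\<^sub>R w (t - s))" for t
    using lborel_integrable_real_affine[OF kconv_integrable[OF e(1) w, of t], of "-1" t] by simp
  \<comment> \<open>\<open>v\<close> is -l on the negative axis and hence in general not causal. The
    whole-line convolution of the constant l with \<open>e\<close> is exactly J l, so no tail term
    appears.\<close>
  have v_eq: "v t = \<kappa> * kconv e v t + (h t - h\<^sub>0)" for t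
  proof -
    have kv: "kconv e v t = kconv e w t - of_real J * l"
      using Bochner_Integration.integral_diff[OF int[of t] integrable_scaleR_left[OF e(2), of l]] e(2)
      by (simp add: kconv_commute v_def right_diff_distrib J_def scaleR_conv_of_real)
    show ?thesis
      unfolding kv using arg_cong2[where f = "(-)", OF eq[of t] l] by (simp add: v_def[of t] algebra_simps)
  qed
  have step: "\<forall>\<^sub>F t in at_top. norm (v t) \<le> r ^ n * C" for n
  proof (induction n)
    case 0
    then show ?case using vC by simp
  next
    case (Suc n)
    define b where "b = r ^ n * C"
    have b: "b > 0" using r C by (simp add: b_def)
    from Suc obtain T where T: "\<And>t. t \<ge> T \<Longrightarrow> norm (v t) \<le> b"
      by (auto simp: eventually_at_top_linorder b_def)
    \<comment> \<open>A majorant of |v| that has the limit b, so that \<open>kconv_tendsto\<close>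
      controls its convolution.\<close>
    define g where "g t = (if t \<ge> T then b else C)" for t
    have [measurable]: "g \<in> borel_measurable borel" unfolding g_def by measurable
    have g: "0 \<le> g t" "g t \<le> b + C" "norm (v t) \<le> g t" for t using b C T vC by (auto simp: g_def)
    have "(g \<longlongrightarrow> b) at_top"
      by (rule tendsto_eventually) (use eventually_ge_at_top[of T] in eventually_elim, simp add: g_def)
    then have "(kconv e g \<longlongrightarrow> J *\<^sub>R b) at_top"
      unfolding J_def using g by (intro kconv_tendsto[OF e(2), of _ "b + C"]) auto
    then have "((\<lambda>t. norm \<kappa> * kconv e g t) \<longlongrightarrow> norm \<kappa> * (J *\<^sub>R b)) at_top"
      by (intro tendsto_mult tendsto_const)
    moreover have "norm \<kappa> * (J *\<^sub>R b) = q * b" by (simp add: q_def)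
    moreover have "q * b < q * b + (r - q) * b / 2" using r b by simp
    ultimately have 1: "\<forall>\<^sub>F t in at_top. norm \<kappa> * kconv e g t < q * b + (r - q) * b / 2"
      using order_tendstoD(2) by metis
    have 2: "\<forall>\<^sub>F t in at_top. dist (h t) h\<^sub>0 < (r - q) * b / 2"
      using r b by (intro tendstoD[OF h(2)]) simp
    show ?case
      using 1 2
    proof eventually_elim
      case (elim t)
      have "norm (kconv e v t) \<le> kconv e g t"
        unfolding kconv_commute
      proof (rule Bochner_Integration.integral_norm_bound_integral)
        have "integrable lborel (\<lambda>s. e s *\<^sub>R w (t - s) - e s *\<^sub>R l)"
          using int e(2) by simp
        then show "integrable lborel (\<lambda>s. e s *\<^sub>R v (t - s))"
          by (simp add: v_def scaleR_diff_right)
        show "integrable lborel (\<lambda>s. e s *\<^sub>R g (t - s))"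
          by (rule Bochner_Integration.integrable_bound[OF integrable_mult_left[OF e(2), of "b + C"]])
             (use e(3) g b C in \<open>auto simp: abs_mult intro!: mult_left_mono\<close>)
        show "norm (e s *\<^sub>R v (t - s)) \<le> e s *\<^sub>R g (t - s)" for s
          using e(3)[of s] g(3)[of "t - s"] by (simp add: mult_left_mono)
      qed
      then have "norm (\<kappa> * kconv e v t) \<le> norm \<kappa> * kconv e g t"
        by (simp add: norm_mult mult_left_mono)
      then have "norm (v t) \<le> norm \<kappa> * kconv e g t + dist (h t) h\<^sub>0"
        using norm_triangle_ineq[of "\<kappa> * kconv e v t" "h t - h\<^sub>0"] v_eq[of t]
        by (simp add: dist_norm)
      also have "\<dots> \<le> q * b + (r - q) * b / 2 + (r - q) * b / 2" using elim by linarith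
      also have "\<dots> = r * b" by (simp add: field_simps)
      finally show ?case by (simp add: b_def)
    qed
  qed
  have "(v \<longlongrightarrow> 0) at_top"
  proof (rule tendstoI)
    fix \<epsilon> :: real assume "\<epsilon> > 0"
    have "(\<lambda>n. r ^ n * C) \<longlonglongrightarrow> 0"
      using r by (intro tendsto_mult_left_zero LIMSEQ_realpow_zero) auto
    from order_tendstoD(2)[OF this \<open>\<epsilon> > 0\<close>] obtain n where "r ^ n * C < \<epsilon>"
      by (auto simp: eventually_sequentially)
    then show "\<forall>\<^sub>F t in at_top. dist (v t) 0 < \<epsilon>"
      using step[of n] by (auto elim: eventually_mono)
  qed
  then have "((\<lambda>t. v t + l) \<longlongrightarrow> 0 + l) at_top" by (intro tendsto_add tendsto_const)
  then show ?thesis by (auto simp: v_def)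
qed

text \<open>On the Laplace side, M s^(-\<sigma>) / (s^\<gamma> + M) = s^(-\<sigma>) -
  s^(\<gamma>-\<sigma>) / (s^\<gamma> + M). The identity trades the kernel of a fractional integral,
  which is not integrable, for a Mittag-Leffler kernel.\<close>

lemma kconv_ml_rl_kernel:
  fixes f :: "real \<Rightarrow> complex"
  assumes \<gamma>: "\<gamma> > 0" and M: "M > 0" and \<sigma>: "\<sigma> > 0" and f: "loc_bdd f"
  shows "M *\<^sub>R kconv (ml_kernel \<gamma> M \<gamma>) (kconv (rl_kernel \<sigma>) f) t =
    kconv (rl_kernel \<sigma>) f t - kconv (ml_kernel \<gamma> M \<sigma>) f t"
proof -
  have "kconv (ml_kernel \<gamma> M \<gamma>) (rl_kernel \<sigma>) u = kconv (rl_kernel \<sigma>) (ml_kernel \<gamma> M \<gamma>) u" for u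
    by (subst kconv_commute) (simp add: kconv_def mult.commute)
  then have "kconv (ml_kernel \<gamma> M \<gamma>) (rl_kernel \<sigma>) u = ml_kernel \<gamma> M (\<sigma> + \<gamma>) u" for u
    using kconv_rl_ml_kernel[OF \<gamma> M \<gamma> \<sigma>, of u] by (simp add: add.commute)
  then have *: "kconv (ml_kernel \<gamma> M \<gamma>) (rl_kernel \<sigma>) = ml_kernel \<gamma> M (\<sigma> + \<gamma>)" by blast
  have "kconv (ml_kernel \<gamma> M \<gamma>) (kconv (rl_kernel \<sigma>) f) t = kconv (ml_kernel \<gamma> M (\<sigma> + \<gamma>)) f t"
    using kconv_assoc[OF ml_kernel_loc_int[OF \<gamma> M \<gamma>] rl_kernel_loc_int[OF \<sigma>] f, of t] by (simp add: *)
  moreover have "kconv (ml_kernel \<gamma> M \<sigma>) f t = kconv (rl_kernel \<sigma>) f t - M *\<^sub>R kconv (ml_kernel \<gamma> M (\<sigma> + \<gamma>)) f t"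
    using kconv_kernel_diff[OF rl_kernel_loc_int[OF \<sigma>] ml_kernel_loc_int[OF \<gamma> M, of "\<sigma> + \<gamma>"] f, of M t] \<sigma> \<gamma>
    by (simp add: ml_kernel_recurrence[OF \<gamma> M \<sigma>, abs_def])
  ultimately show ?thesis by simp
qed

lemma kconv_rl_rl_kernel:
  fixes f :: "real \<Rightarrow> complex"
  assumes "a > 0" "b > 0" "loc_bdd f"
  shows "kconv (rl_kernel a) (kconv (rl_kernel b) f) = kconv (rl_kernel (a + b)) f"
proof -
  have "kconv (rl_kernel a) (rl_kernel b) = rl_kernel (a + b)"
    using kconv_rl_kernel[OF assms(1,2)] by blast
  then show ?thesis
    using kconv_assoc[OF rl_kernel_loc_int[OF assms(1)] rl_kernel_loc_int[OF assms(2)] assms(3)] by auto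
qed

text \<open>If a fractional integral stays convergent, its integrand cannot have a nonzero limit: convolving
  with the resolvent of $s^\delta + 1$, whose integral is 1, turns the integral into a fixed point.\<close>

lemma rl_integrand_limit_zero:
  fixes w \<phi> :: "real \<Rightarrow> complex"
  assumes \<delta>: "0 < \<delta>" "\<delta> < 1" and \<phi>: "loc_bdd \<phi>" "(\<phi> \<longlongrightarrow> m) at_top"
    and lim: "(kconv (rl_kernel \<delta>) \<phi> \<longlongrightarrow> l) at_top"
  shows "m = 0"
proof -
  let ?e = "ml_kernel \<delta> 1 \<delta>" and ?v = "kconv (rl_kernel \<delta>) \<phi>"
  have e: "loc_int ?e" using \<delta> by (simp add: ml_resolvent_loc_int)
  have v: "loc_bdd ?v" using \<delta> \<phi> by (simp add: kconv_loc_bdd rl_kernel_loc_int)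
  have "?v t = kconv ?e (\<lambda>s. ?v s + \<phi> s) t" for t
    using kconv_ml_rl_kernel[OF \<delta>(1) _ \<delta>(1) \<phi>(1), of 1 t] kconv_add[OF e v \<phi>(1), of t] by simp
  moreover have "(kconv ?e (\<lambda>s. ?v s + \<phi> s) \<longlongrightarrow> integral\<^sup>L lborel ?e *\<^sub>R (l + m)) at_top"
  proof -
    have vp: "loc_bdd (\<lambda>s. ?v s + \<phi> s)" "((\<lambda>s. ?v s + \<phi> s) \<longlongrightarrow> l + m) at_top"
      by (intro loc_bdd_add v \<phi> tendsto_add lim)+
    obtain B where "\<And>t. norm (?v t + \<phi> t) \<le> B" by (rule loc_bdd_tendsto_bounded[OF vp]) blast
    then show ?thesis
      using \<delta> by (intro kconv_tendsto[OF _ loc_bdd_measurable[OF vp(1)] _ vp(2)] ml_resolvent_integrable) auto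
  qed
  ultimately have "(?v \<longlongrightarrow> integral\<^sup>L lborel ?e *\<^sub>R (l + m)) at_top" by (metis ext)
  then have "(?v \<longlongrightarrow> l + m) at_top" using \<delta> by (simp add: integral_ml_resolvent)
  then show ?thesis using tendsto_unique[OF _ lim] by fastforce
qed

text \<open>The discs with centre -M and radius M exhaust the open left half-plane. The chosen M
  gives M Re \<nu> = -(|\<nu>|^2 + 1), so the cross term 2 M Re \<nu> outweighs |\<nu>|^2.\<close>

lemma exists_shift_contraction:
  assumes "Re \<nu> < 0"
  obtains M where "M > 0" "norm (of_real M + \<nu>) < M"
proof -
  define M where "M = ((norm \<nu>)\<^sup>2 + 1) / (- Re \<nu>)"
  have M: "M > 0"
    unfolding M_def by (rule divide_pos_pos) (use assms in \<open>auto intro: add_nonneg_pos\<close>)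
  have "M * Re \<nu> = - ((norm \<nu>)\<^sup>2 + 1)" using assms by (simp add: M_def)
  moreover have "(norm (of_real M + \<nu>))\<^sup>2 = M\<^sup>2 + 2 * (M * Re \<nu>) + (norm \<nu>)\<^sup>2"
    by (simp add: cmod_power2 power2_sum algebra_simps)
  ultimately have "(norm (of_real M + \<nu>))\<^sup>2 < M\<^sup>2" using zero_le_power2[of "norm \<nu>"] by linarith
  then show ?thesis using M that power2_less_imp_less[of "norm (of_real M + \<nu>)" M] by simp
qed

text \<open>Subtracting the step of height c moves the initial value into the forcing, whose limit
  is then \<mu> c. The contraction therefore yields only a limit of w; that it is zero follows
  because the integrand of a convergent fractional integral cannot have a nonzero limit.\<close>

lemma scalar_volterra_tendsto_zero:
  fixes w f :: "real \<Rightarrow> complex"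
  assumes \<delta>: "0 < \<delta>" and n: "n > 0" "real n * \<delta> < 1" and re: "Re (\<mu> ^ n) < 0"
    and w: "loc_bdd w" and f: "loc_bdd f" "(f \<longlongrightarrow> 0) at_top"
    and eq: "\<And>t. w t = indicator {0..} t * c + kconv (rl_kernel \<delta>) (\<lambda>s. \<mu> * w s + f s) t"
  shows "(w \<longlongrightarrow> 0) at_top"
proof -
  define \<gamma> where "\<gamma> = real n * \<delta>"
  have \<gamma>: "0 < \<gamma>" "\<gamma> < 1" using \<delta> n by (auto simp: \<gamma>_def)
  have \<delta>\<gamma>: "\<delta> \<le> \<gamma>" using \<delta> n by (simp add: \<gamma>_def)
  have K: "loc_int (rl_kernel a)" if "a > 0" for a using that by (rule rl_kernel_loc_int)
  define v where "v t = w t - indicator {0..} t * c" for t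
  define f' where "f' t = f t + \<mu> * c * indicator {0..} t" for t
  have step: "loc_bdd (\<lambda>t. a * (indicator {0..} t :: complex))" for a
    by (intro loc_bdd_mult loc_bdd_step)
  have v: "loc_bdd v"
    using loc_bdd_add[OF w step[of "-c"]] by (simp add: v_def[abs_def] mult.commute)
  have f': "loc_bdd f'"
    unfolding f'_def by (intro loc_bdd_add f step)
  have step_lim: "((indicator {0..} :: real \<Rightarrow> complex) \<longlongrightarrow> 1) at_top"
    by (rule tendsto_eventually) (use eventually_ge_at_top[of 0] in eventually_elim, simp)
  have f'_lim: "(f' \<longlongrightarrow> 0 + \<mu> * c * 1) at_top"
    unfolding f'_def by (intro tendsto_intros f step_lim)
  \<comment> \<open>The geometric sum: the equation for \<open>v\<close> is inserted into its own
    integral \<open>j\<close> times, and the semigroup law collects the orders.\<close>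
  have iter: "v t = \<mu> ^ Suc j * kconv (rl_kernel (real (Suc j) * \<delta>)) v t
      + (\<Sum>i<Suc j. \<mu> ^ i * kconv (rl_kernel (real (Suc i) * \<delta>)) f' t)" for j t
  proof (induction j arbitrary: t)
    case 0
    have "(\<lambda>s. \<mu> * w s + f s) = (\<lambda>s. \<mu> * v s + f' s)" by (auto simp: v_def f'_def algebra_simps)
    then show ?case
      using eq[of t] kconv_add[OF K[OF \<delta>] loc_bdd_mult[OF v] f', of \<mu> t] by (simp add: v_def[of t] kconv_mult)
  next
    case (Suc j)
    have j: "real (Suc j) * \<delta> > 0" using \<delta> by simp
    have vf: "v = (\<lambda>s. \<mu> * kconv (rl_kernel \<delta>) v s + kconv (rl_kernel \<delta>) f' s)"
    proof
      fix s
      have "(\<lambda>s. \<mu> * w s + f s) = (\<lambda>s. \<mu> * v s + f' s)" by (auto simp: v_def f'_def algebra_simps)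
      then show "v s = \<mu> * kconv (rl_kernel \<delta>) v s + kconv (rl_kernel \<delta>) f' s"
        using eq[of s] kconv_add[OF K[OF \<delta>] loc_bdd_mult[OF v] f', of \<mu> s] by (simp add: v_def[of s] kconv_mult)
    qed
    have "kconv (rl_kernel (real (Suc j) * \<delta>)) v t =
      kconv (rl_kernel (real (Suc j) * \<delta>)) (\<lambda>s. \<mu> * kconv (rl_kernel \<delta>) v s + kconv (rl_kernel \<delta>) f' s) t"
      using vf by metis
    also have "\<dots> = \<mu> * kconv (rl_kernel (real (Suc j) * \<delta> + \<delta>)) v t + kconv (rl_kernel (real (Suc j) * \<delta> + \<delta>)) f' t"
      using kconv_rl_rl_kernel[OF j \<delta> v] kconv_rl_rl_kernel[OF j \<delta> f']
        kconv_add[OF K[OF j] loc_bdd_mult[OF kconv_loc_bdd[OF K[OF \<delta>] v]] kconv_loc_bdd[OF K[OF \<delta>] f'], of \<mu> t]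
      by (simp add: kconv_mult)
    also have "real (Suc j) * \<delta> + \<delta> = real (Suc (Suc j)) * \<delta>" by (simp add: algebra_simps)
    finally have "\<mu> ^ Suc j * kconv (rl_kernel (real (Suc j) * \<delta>)) v t =
      \<mu> ^ Suc (Suc j) * kconv (rl_kernel (real (Suc (Suc j)) * \<delta>)) v t
      + \<mu> ^ Suc j * kconv (rl_kernel (real (Suc (Suc j)) * \<delta>)) f' t"
      by (simp add: algebra_simps)
    then show ?case using Suc.IH[of t] by simp
  qed
  define \<nu> where "\<nu> = \<mu> ^ n"
  obtain M where M: "M > 0" "norm (of_real M + \<nu>) < M"
    using exists_shift_contraction[of \<nu>] re by (auto simp: \<nu>_def)
  let ?e = "ml_kernel \<gamma> M \<gamma>"
  have e: "loc_int ?e" using \<gamma> M by (simp add: ml_resolvent_loc_int)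
  define \<sigma> where "\<sigma> i = real (Suc i) * \<delta>" for i
  have \<sigma>: "0 < \<sigma> i" "\<sigma> i \<le> \<gamma>" if "i < n" for i
    using that \<delta> by (auto simp: \<sigma>_def \<gamma>_def intro!: mult_right_mono)
  have iter_n: "v t = \<nu> * kconv (rl_kernel \<gamma>) v t + (\<Sum>i<n. \<mu> ^ i * kconv (rl_kernel (\<sigma> i)) f' t)" for t
    using iter[of t "n - 1"] n by (simp add: \<nu>_def \<gamma>_def \<sigma>_def)
  define h where "h t = (\<Sum>i<n. \<mu> ^ i * kconv (ml_kernel \<gamma> M (\<sigma> i)) f' t)" for t
  have h: "loc_bdd h"
    unfolding h_def using \<sigma> \<gamma> M
    by (intro loc_bdd_sum loc_bdd_mult kconv_loc_bdd f' ml_kernel_loc_int) auto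
  \<comment> \<open>Applying M e to \<open>iter_n\<close> and replacing every M e * k_\<sigma> by
    k_\<sigma> minus its Mittag-Leffler kernel reproduces the right-hand side of
    \<open>iter_n\<close>, that is v, minus \<nu> (e * v) and minus \<open>h\<close>.\<close>
  have v_eq: "v t = (of_real M + \<nu>) * kconv ?e v t + h t" for t
  proof -
    have "kconv ?e v t = kconv ?e (\<lambda>t. \<nu> * kconv (rl_kernel \<gamma>) v t + (\<Sum>i<n. \<mu> ^ i * kconv (rl_kernel (\<sigma> i)) f' t)) t"
      using iter_n by (metis ext)
    also have "\<dots> = \<nu> * kconv ?e (kconv (rl_kernel \<gamma>) v) t + (\<Sum>i<n. \<mu> ^ i * kconv ?e (kconv (rl_kernel (\<sigma> i)) f') t)"
      using \<sigma> \<gamma> v f'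
      by (subst kconv_add[OF e] kconv_sum[OF e] | intro loc_bdd_sum loc_bdd_mult kconv_loc_bdd K | simp add: kconv_mult)+
    finally have "of_real M * kconv ?e v t = \<nu> * (M *\<^sub>R kconv ?e (kconv (rl_kernel \<gamma>) v) t)
      + (\<Sum>i<n. \<mu> ^ i * (M *\<^sub>R kconv ?e (kconv (rl_kernel (\<sigma> i)) f') t))"
      by (simp add: scaleR_conv_of_real algebra_simps sum_distrib_left)
    also have "\<dots> = \<nu> * (kconv (rl_kernel \<gamma>) v t - kconv ?e v t)
      + (\<Sum>i<n. \<mu> ^ i * (kconv (rl_kernel (\<sigma> i)) f' t - kconv (ml_kernel \<gamma> M (\<sigma> i)) f' t))"
      using \<sigma> by (simp add: kconv_ml_rl_kernel[OF \<gamma>(1) M(1)] \<gamma> v f')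
    also have "\<dots> = v t - \<nu> * kconv ?e v t - h t"
      using iter_n[of t] by (simp add: h_def algebra_simps sum_subtractf)
    finally show ?thesis by (simp add: algebra_simps)
  qed
  obtain B where B: "\<And>t. norm (f' t) \<le> B" by (rule loc_bdd_tendsto_bounded[OF f' f'_lim]) blast
  have h_lim: "(h \<longlongrightarrow> (\<Sum>i<n. \<mu> ^ i * (integral\<^sup>L lborel (ml_kernel \<gamma> M (\<sigma> i)) *\<^sub>R (0 + \<mu> * c * 1)))) at_top"
    unfolding h_def using \<sigma> \<gamma> M
    by (intro tendsto_sum tendsto_mult tendsto_const kconv_tendsto[OF _ loc_bdd_measurable[OF f'] B f'_lim] ml_kernel_integrable) auto
  have "norm (of_real M + \<nu>) * integral\<^sup>L lborel ?e < 1"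
    using M by (simp add: integral_ml_resolvent[OF \<gamma> M(1)])
  from volterra_contraction_converges[OF e ml_resolvent_integrable[OF \<gamma> M(1)] ml_resolvent_nonneg[OF \<gamma> M(1)] this v h h_lim v_eq]
  obtain l where v_lim: "(v \<longlongrightarrow> l) at_top" by blast
  have w_lim: "(w \<longlongrightarrow> l + 1 * c) at_top"
    using tendsto_add[OF v_lim tendsto_mult[OF step_lim tendsto_const[of c]]] by (simp add: v_def)
  have "v t = kconv (rl_kernel \<delta>) (\<lambda>s. \<mu> * w s + f s) t" for t using eq[of t] by (simp add: v_def)
  then have "v = kconv (rl_kernel \<delta>) (\<lambda>s. \<mu> * w s + f s)" by (rule ext)
  moreover have "((\<lambda>s. \<mu> * w s + f s) \<longlongrightarrow> \<mu> * (l + 1 * c) + 0) at_top"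
    by (intro tendsto_intros w_lim f)
  \<comment> \<open>The integrand \<mu> w + f has this limit and its fractional integral is the
    convergent \<open>v\<close>. Below, Re (\<mu>^n) < 0 excludes \<mu> = 0.\<close>
  ultimately have "\<mu> * (l + 1 * c) + 0 = 0"
    using v_lim \<delta> \<delta>\<gamma> \<gamma> by (intro rl_integrand_limit_zero[of \<delta> "\<lambda>s. \<mu> * w s + f s" _ l] loc_bdd_add loc_bdd_mult w f) auto
  moreover have "\<mu> \<noteq> 0" using re n by (auto simp: power_0_left)
  ultimately show ?thesis using w_lim by simp
qed

section \<open>Systems of a single order\<close>

lemma complex_schur_exists:
  fixes S :: "complex mat"
  assumes S: "S \<in> carrier_mat m m"
  obtains B P Q where "similar_mat_wit S B P Q" "upper_triangular B"
    "\<And>i. i < m \<Longrightarrow> eigenvalue S (B $$ (i, i))"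
proof -
  obtain es where es: "char_poly S = (\<Prod>a\<leftarrow>es. [:- a, 1:])" using char_poly_factorized[OF S] by blast
  obtain B P Q where BPQ: "schur_decomposition S es = (B, P, Q)" by (cases "schur_decomposition S es") auto
  from schur_decomposition[OF S es BPQ]
  have sim: "similar_mat_wit S B P Q" and ut: "upper_triangular B" and diag: "diag_mat B = es" by auto
  have B: "B \<in> carrier_mat m m" using similar_mat_witD2[OF S sim] by auto
  have "eigenvalue S (B $$ (i, i))" if "i < m" for i
  proof -
    have "B $$ (i, i) \<in> set es" using diag B that by (auto simp: diag_mat_def)
    then show ?thesis
      by (auto simp: eigenvalue_root_char_poly[OF S] es poly_prod_list prod_list_zero_iff)
  qed
  with sim ut show ?thesis by (rule that)
qed

lemma mult_mat_entry:
  assumes "A \<in> carrier_mat m m" "B \<in> carrier_mat m m" "i < m" "j < m"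
  shows "(A * B) $$ (i, j) = (\<Sum>k<m. A $$ (i, k) * B $$ (k, j))"
  using assms by (auto simp: scalar_prod_def lessThan_atLeast0 intro!: sum.cong)

lemma sum_mult_mat:
  fixes A B :: "complex mat"
  assumes "A \<in> carrier_mat m m" "B \<in> carrier_mat m m" "i < m"
  shows "(\<Sum>j<m. A $$ (i, j) * (\<Sum>k<m. B $$ (j, k) * f k)) = (\<Sum>k<m. (A * B) $$ (i, k) * f k)"
proof -
  have "(\<Sum>k<m. (A * B) $$ (i, k) * f k) = (\<Sum>k<m. \<Sum>j<m. A $$ (i, j) * (B $$ (j, k) * f k))"
    by (intro sum.cong refl) (simp add: mult_mat_entry[OF assms] sum_distrib_right mult.assoc)
  also have "\<dots> = (\<Sum>j<m. \<Sum>k<m. A $$ (i, j) * (B $$ (j, k) * f k))" by (rule sum.swap)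
  finally show ?thesis by (simp add: sum_distrib_left)
qed

lemma volterra_system_tendsto_zero:
  fixes S :: "complex mat" and y G :: "nat \<Rightarrow> real \<Rightarrow> complex"
  assumes S: "S \<in> carrier_mat m m" and \<delta>: "\<delta> > 0"
    and spec: "\<And>l. eigenvalue S l \<Longrightarrow> \<exists>n>0. real n * \<delta> < 1 \<and> Re (l ^ n) < 0"
    and y: "\<And>i. i < m \<Longrightarrow> loc_bdd (y i)"
    and G: "\<And>i. i < m \<Longrightarrow> loc_bdd (G i)" "\<And>i. i < m \<Longrightarrow> (G i \<longlongrightarrow> 0) at_top"
    and eq: "\<And>i t. i < m \<Longrightarrow> y i t = indicator {0..} t * c i
      + kconv (rl_kernel \<delta>) (\<lambda>s. (\<Sum>j<m. S $$ (i, j) * y j s) + G i s) t"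
    and i: "i < m"
  shows "(y i \<longlongrightarrow> 0) at_top"
proof -
  obtain B P Q where sim: "similar_mat_wit S B P Q" and ut: "upper_triangular B"
    and ev: "\<And>i. i < m \<Longrightarrow> eigenvalue S (B $$ (i, i))"
    using complex_schur_exists[OF S] by blast
  note mats = similar_mat_witD2[OF S sim]
  have K: "loc_int (rl_kernel \<delta>)" by (rule rl_kernel_loc_int[OF \<delta>])
  have QS: "Q * S = B * Q"
  proof -
    have BQ: "B * Q \<in> carrier_mat m m" by (rule mult_carrier_mat[OF mats(5,7)])
    have "S = P * (B * Q)" unfolding mats(3) by (rule assoc_mult_mat[OF mats(6,5,7)])
    then have "Q * S = Q * P * (B * Q)" using assoc_mult_mat[OF mats(7,6) BQ] by simp
    then show ?thesis unfolding mats(2) left_mult_one_mat[OF BQ] .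
  qed
  define z where "z i t = (\<Sum>j<m. Q $$ (i, j) * y j t)" for i t
  have z: "loc_bdd (z i)" for i
    unfolding z_def by (intro loc_bdd_sum loc_bdd_mult y) auto
  define D where "D i t = (\<Sum>j<m. Q $$ (i, j) * G j t)" for i t
  have D: "loc_bdd (D i)" for i
    unfolding D_def by (intro loc_bdd_sum loc_bdd_mult G) auto
  have "((\<lambda>t. \<Sum>j<m. Q $$ (i, j) * G j t) \<longlongrightarrow> (\<Sum>j<m. Q $$ (i, j) * 0)) at_top" for i
    by (intro tendsto_sum tendsto_mult tendsto_const G) auto
  then have D_lim: "(D i \<longlongrightarrow> 0) at_top" for i by (simp add: D_def[abs_def])
  have z_eq: "z i t = indicator {0..} t * (\<Sum>j<m. Q $$ (i, j) * c j)
      + kconv (rl_kernel \<delta>) (\<lambda>s. (\<Sum>k<m. B $$ (i, k) * z k s) + D i s) t" if i: "i < m" for i t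
  proof -
    define R where "R j s = (\<Sum>k<m. S $$ (j, k) * y k s) + G j s" for j s
    have R: "loc_bdd (R j)" if "j < m" for j
      unfolding R_def by (intro loc_bdd_add loc_bdd_sum loc_bdd_mult y G that) auto
    have "z i t = (\<Sum>j<m. Q $$ (i, j) * (indicator {0..} t * c j + kconv (rl_kernel \<delta>) (R j) t))"
      unfolding z_def R_def by (intro sum.cong arg_cong2[where f = "(*)"] refl eq) auto
    also have "\<dots> = indicator {0..} t * (\<Sum>j<m. Q $$ (i, j) * c j)
      + (\<Sum>j<m. kconv (rl_kernel \<delta>) (\<lambda>s. Q $$ (i, j) * R j s) t)"
      by (simp add: kconv_mult distrib_left sum.distrib sum_distrib_left mult.left_commute)
    also have "(\<Sum>j<m. kconv (rl_kernel \<delta>) (\<lambda>s. Q $$ (i, j) * R j s) t) =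
      kconv (rl_kernel \<delta>) (\<lambda>s. \<Sum>j<m. Q $$ (i, j) * R j s) t"
      by (intro kconv_sum[OF K, symmetric] loc_bdd_mult R) auto
    also have "(\<lambda>s. \<Sum>j<m. Q $$ (i, j) * R j s) = (\<lambda>s. (\<Sum>k<m. B $$ (i, k) * z k s) + D i s)"
    proof
      fix s
      have "(\<Sum>j<m. Q $$ (i, j) * (\<Sum>k<m. S $$ (j, k) * y k s)) = (\<Sum>k<m. (Q * S) $$ (i, k) * y k s)"
        by (rule sum_mult_mat[OF mats(7) S i])
      also have "\<dots> = (\<Sum>k<m. B $$ (i, k) * z k s)"
        unfolding QS z_def by (rule sum_mult_mat[OF mats(5,7) i, symmetric])
      finally show "(\<Sum>j<m. Q $$ (i, j) * R j s) = (\<Sum>k<m. B $$ (i, k) * z k s) + D i s"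
        by (simp add: R_def D_def distrib_left sum.distrib)
    qed
    finally show ?thesis .
  qed
  have z_lim: "(z i \<longlongrightarrow> 0) at_top" if "i < m" for i
    using that
  \<comment> \<open>Back substitution from the last row: the components with larger index already
    decay and join the forcing of row i.\<close>
  proof (induction "m - i" arbitrary: i rule: less_induct)
    case less
    define F where "F s = (\<Sum>k\<in>{i<..<m}. B $$ (i, k) * z k s) + D i s" for s
    have split: "(\<Sum>k<m. B $$ (i, k) * z k s) + D i s = B $$ (i, i) * z i s + F s" for s
    proof -
      have "(\<Sum>k<m. B $$ (i, k) * z k s) = (\<Sum>k\<in>insert i {i<..<m}. B $$ (i, k) * z k s)"
      proof (rule sum.mono_neutral_right)
        show "\<forall>k\<in>{..<m} - insert i {i<..<m}. B $$ (i, k) * z k s = 0"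
        proof
          fix k assume "k \<in> {..<m} - insert i {i<..<m}"
          then have "k < i" by auto
          then show "B $$ (i, k) * z k s = 0"
            using upper_triangularD[OF ut, of k i] carrier_matD(1)[OF mats(5)] less.prems by simp
        qed
      qed (use less.prems in auto)
      then show ?thesis by (simp add: F_def)
    qed
    have "((\<lambda>s. (\<Sum>k\<in>{i<..<m}. B $$ (i, k) * z k s) + D i s) \<longlongrightarrow> (\<Sum>k\<in>{i<..<m}. B $$ (i, k) * 0) + 0) at_top"
      using less.hyps by (intro tendsto_add tendsto_sum tendsto_mult tendsto_const D_lim) auto
    then have F_lim: "(F \<longlongrightarrow> 0) at_top" by (simp add: F_def[abs_def])
    have F: "loc_bdd F" unfolding F_def by (intro loc_bdd_add loc_bdd_sum loc_bdd_mult z D)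
    obtain n where n: "n > 0" "real n * \<delta> < 1" "Re ((B $$ (i, i)) ^ n) < 0"
      using spec[OF ev[OF less.prems]] by blast
    show ?case
      by (rule scalar_volterra_tendsto_zero[OF \<delta> n z F F_lim z_eq[OF less.prems, unfolded split]])
  qed
  have y_eq: "y i t = (\<Sum>j<m. P $$ (i, j) * z j t)" for t
  proof -
    have "(\<Sum>j<m. P $$ (i, j) * z j t) = (\<Sum>k<m. (P * Q) $$ (i, k) * y k t)"
      unfolding z_def by (rule sum_mult_mat[OF mats(6,7) i])
    also have "\<dots> = (\<Sum>k<m. if k = i then y k t else 0)"
      unfolding mats(1) using i by (intro sum.cong) auto
    finally show ?thesis using i by simp
  qed
  have "((\<lambda>t. \<Sum>j<m. P $$ (i, j) * z j t) \<longlongrightarrow> (\<Sum>j<m. P $$ (i, j) * 0)) at_top"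
    using z_lim by (intro tendsto_sum tendsto_mult tendsto_const) auto
  then show ?thesis by (simp add: y_eq[abs_def])
qed

section \<open>The block companion matrix and its eigenvalues\<close>

lemma sum_lessThan_blocks:
  fixes r :: "nat \<Rightarrow> nat" and F :: "nat \<Rightarrow> 'a::comm_monoid_add"
  shows "(\<Sum>n<(\<Sum>j<d. r j). F n) = (\<Sum>j<d. \<Sum>m<r j. F ((\<Sum>i<j. r i) + m))"
proof -
  have "(\<Sum>n<a + b. F n) = (\<Sum>n<a. F n) + (\<Sum>m<b. F (a + m))" for a b
    by (induction b) (simp_all add: add.assoc)
  then show ?thesis by (induction d) simp_all
qed

lemma block_index_cases:
  fixes r :: "nat \<Rightarrow> nat"
  assumes "n < (\<Sum>j<d. r j)"
  obtains j m where "j < d" "m < r j" "n = (\<Sum>i<j. r i) + m"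
  using assms
proof (induction d arbitrary: thesis)
  case (Suc d)
  show ?case
  proof (cases "n < (\<Sum>j<d. r j)")
    case True
    then show ?thesis using Suc.IH Suc.prems(1) less_SucI by metis
  next
    case False
    then show ?thesis
      using Suc.prems by (intro Suc.prems(1)[of d "n - (\<Sum>j<d. r j)"]) auto
  qed
qed simp

text \<open>Companion structure: inside a block a row shifts to the next entry, and the last row
  couples the heads of all blocks. It serves both the eigenvector equations and, with V the values
  of the components at one time, the companion system.\<close>

lemma star_mat_row:
  fixes V :: "nat \<Rightarrow> complex"
  assumes r: "\<And>k. k < d \<Longrightarrow> r k > 0" and j: "j < d" and m: "m < r j"
  shows "(\<Sum>n<(\<Sum>k<d. r k). star_mat d A r $$ ((\<Sum>i<j. r i) + m, n) * V n) =
    (if Suc m = r j then \<Sum>k<d. A $$ (j, k) * V (\<Sum>i<k. r i) else V ((\<Sum>i<j. r i) + Suc m))"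
proof -
  have "(\<Sum>n<(\<Sum>k<d. r k). star_mat d A r $$ ((\<Sum>i<j. r i) + m, n) * V n) =
    (\<Sum>k<d. \<Sum>n<r k. star_block A r j k $$ (m, n) * V ((\<Sum>i<k. r i) + n))"
    unfolding sum_lessThan_blocks by (intro sum.cong refl) (simp add: star_mat_block j m)
  also have "\<dots> = (\<Sum>k<d. \<Sum>n<r k. (if Suc m = r j then if n = 0 then A $$ (j, k) * V (\<Sum>i<k. r i) else 0
      else if n = Suc m then if k = j then V ((\<Sum>i<j. r i) + Suc m) else 0 else 0))"
    using m by (intro sum.cong refl) (auto simp: star_block_def)
  also have "\<dots> = (if Suc m = r j then \<Sum>k<d. A $$ (j, k) * V (\<Sum>i<k. r i) else V ((\<Sum>i<j. r i) + Suc m))"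
  proof (cases "Suc m = r j")
    case True
    then show ?thesis using r by (auto intro!: sum.cong)
  next
    case False
    then have "Suc m < r j" using m by simp
    have "(\<Sum>k<d. \<Sum>n<r k. if n = Suc m then if k = j then V ((\<Sum>i<j. r i) + Suc m) else 0 else 0)
      = (\<Sum>k<d. if k = j then V ((\<Sum>i<j. r i) + Suc m) else 0)"
      using \<open>Suc m < r j\<close> by (intro sum.cong refl) auto
    then show ?thesis using False j by simp
  qed
  finally show ?thesis .
qed

lemma star_mat_mult_vec:
  fixes r :: "nat \<Rightarrow> nat" and v :: "complex vec"
  assumes v: "v \<in> carrier_vec (\<Sum>k<d. r k)" and n: "n < (\<Sum>k<d. r k)"
  shows "(star_mat d A r *\<^sub>v v) $ n = (\<Sum>k<(\<Sum>k<d. r k). star_mat d A r $$ (n, k) * v $ k)"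
  using assms star_mat_carrier[of d A r]
  by (auto simp: scalar_prod_def lessThan_atLeast0 intro!: sum.cong)

text \<open>Eigenvectors have the components $l^m u_j$ in block \<open>j\<close>, where
  $\sum_k a_{jk} u_k = l^{r_j} u_j$; multiplying all block sizes by \<open>N\<close> thus replaces \<open>l\<close> by an
  \<open>N\<close>-th root.\<close>

lemma star_mat_eigenvalue_power:
  fixes l :: complex
  assumes r: "\<And>j. j < d \<Longrightarrow> r j > 0" and N: "N > 0"
    and ev: "eigenvalue (star_mat d A (\<lambda>j. N * r j)) l"
  shows "eigenvalue (star_mat d A r) (l ^ N)"
proof -
  let ?r' = "\<lambda>j. N * r j"
  define off where "off j = (\<Sum>i<j. r i)" for j
  define off' where "off' j = (\<Sum>i<j. ?r' i)" for j
  have r': "?r' j > 0" if "j < d" for j using r[OF that] N by simp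
  have C': "star_mat d A ?r' \<in> carrier_mat (off' d) (off' d)"
    unfolding off'_def by (rule star_mat_carrier)
  have C: "star_mat d A r \<in> carrier_mat (off d) (off d)"
    unfolding off_def by (rule star_mat_carrier)
  obtain v where v: "v \<in> carrier_vec (off' d)" "v \<noteq> 0\<^sub>v (off' d)" "star_mat d A ?r' *\<^sub>v v = l \<cdot>\<^sub>v v"
    using ev C' by (auto simp: eigenvalue_def eigenvector_def)
  have row: "l * v $ (off' j + m) = (if Suc m = ?r' j then \<Sum>k<d. A $$ (j, k) * v $ off' k else v $ (off' j + Suc m))"
    if j: "j < d" and m: "m < ?r' j" for j m
  proof -
    have lt: "off' j + m < off' d" unfolding off'_def by (rule offset_less[where r = ?r', OF j m])
    have "l * v $ (off' j + m) = (star_mat d A ?r' *\<^sub>v v) $ (off' j + m)" using v lt by simp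
    also have "\<dots> = (if Suc m = ?r' j then \<Sum>k<d. A $$ (j, k) * v $ off' k else v $ (off' j + Suc m))"
      using star_mat_mult_vec[OF v(1)[unfolded off'_def] lt[unfolded off'_def], of A]
        star_mat_row[where r = ?r' and V = "\<lambda>n. v $ n" and A = A, OF r' j m] unfolding off'_def by simp
    finally show ?thesis .
  qed
  have comp: "v $ (off' j + m) = l ^ m * v $ off' j" if j: "j < d" and m: "m < ?r' j" for j m
    using m
  proof (induction m)
    case (Suc m)
    then show ?case using row[OF j, of m] by (simp add: mult.assoc)
  qed simp
  have last: "(\<Sum>k<d. A $$ (j, k) * v $ off' k) = (l ^ N) ^ r j * v $ off' j" if j: "j < d" for j
  proof -
    obtain s where s: "N * r j = Suc s" using r'[OF j] gr0_implies_Suc by blast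
    have "(\<Sum>k<d. A $$ (j, k) * v $ off' k) = l * v $ (off' j + s)"
      using row[OF j, of s] s by simp
    also have "\<dots> = l * (l ^ s * v $ off' j)" using comp[OF j, of s] s by simp
    also have "\<dots> = l ^ (N * r j) * v $ off' j" by (simp add: s)
    finally show ?thesis by (simp add: power_mult)
  qed
  \<comment> \<open>The heads of the blocks of v are kept; within the shorter blocks the powers of l
    are replaced by powers of l^N.\<close>
  define w where "w = vec (off d) (\<lambda>n. (l ^ N) ^ block_pos r n * v $ off' (block_no r n))"
  have w_comp: "w $ (off j + m) = (l ^ N) ^ m * v $ off' j" if "j < d" "m < r j" for j m
    using that offset_less[of j d m r] by (simp add: w_def off_def block_pos_offset block_no_offset)
  have w: "w \<in> carrier_vec (off d)" by (simp add: w_def)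
  \<comment> \<open>By \<open>comp\<close> the heads determine v, so a vanishing w would force v to
    vanish.\<close>
  have "w \<noteq> 0\<^sub>v (off d)"
  proof
    assume "w = 0\<^sub>v (off d)"
    then have zero: "v $ off' j = 0" if "j < d" for j
      using w_comp[OF that r[OF that]] offset_less[where r = r, OF that r[OF that]] by (simp add: off_def)
    have "v = 0\<^sub>v (off' d)"
    proof (rule eq_vecI)
      fix n assume n: "n < dim_vec (0\<^sub>v (off' d))"
      then have "n < (\<Sum>j<d. ?r' j)" by (simp add: off'_def)
      then obtain j m where "j < d" "m < ?r' j" "n = (\<Sum>i<j. ?r' i) + m" by (rule block_index_cases)
      then show "v $ n = 0\<^sub>v (off' d) $ n"
        using comp[of j m] zero[of j] n by (simp add: off'_def)
    qed (use v in simp)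
    with v(2) show False by simp
  qed
  moreover have "star_mat d A r *\<^sub>v w = (l ^ N) \<cdot>\<^sub>v w"
  proof (rule eq_vecI)
    fix n assume "n < dim_vec ((l ^ N) \<cdot>\<^sub>v w)"
    then have n: "n < (\<Sum>k<d. r k)" using w by (simp add: off_def)
    then obtain j m where jm: "j < d" "m < r j" "n = (\<Sum>i<j. r i) + m" by (rule block_index_cases)
    have "(star_mat d A r *\<^sub>v w) $ n =
        (if Suc m = r j then \<Sum>k<d. A $$ (j, k) * w $ off k else w $ (off j + Suc m))"
      using star_mat_mult_vec[OF w[unfolded off_def] n, of A] star_mat_row[where r = r and V = "\<lambda>n. w $ n" and A = A, OF r jm(1,2)]
      unfolding jm(3) off_def by simp
    also have "\<dots> = (l ^ N) ^ Suc m * v $ off' j"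
    proof (cases "Suc m = r j")
      case True
      have "(\<Sum>k<d. A $$ (j, k) * w $ off k) = (\<Sum>k<d. A $$ (j, k) * v $ off' k)"
        using w_comp[of _ 0] r by (intro sum.cong) auto
      then show ?thesis using True last[OF jm(1)] by simp
    next
      case False
      then show ?thesis using w_comp[OF jm(1), of "Suc m"] jm(2) by simp
    qed
    also have "\<dots> = ((l ^ N) \<cdot>\<^sub>v w) $ n"
      using w_comp[OF jm(1,2)] n w jm(3) by (simp add: off_def)
    finally show "(star_mat d A r *\<^sub>v w) $ n = ((l ^ N) \<cdot>\<^sub>v w) $ n" .
  qed (use w C in auto)
  ultimately show ?thesis
    using w C by (auto simp: eigenvalue_def eigenvector_def)
qed

section \<open>Multi-order systems\<close>

lemma causal_extension_loc_bdd:
  fixes f :: "real \<Rightarrow> complex"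
  assumes f: "continuous_on {0..} f"
  shows "loc_bdd (\<lambda>t. indicator {0..} t *\<^sub>R f t)"
proof -
  have "(\<lambda>t. indicator {0..} t *\<^sub>R f t) \<in> borel_measurable borel"
    by (rule borel_measurable_continuous_on_indicator[OF _ f]) simp
  moreover have "\<exists>B. \<forall>t\<le>T. norm (indicator {0..} t *\<^sub>R f t) \<le> B" for T
  proof -
    have "compact (f ` {0..T})"
      by (intro compact_continuous_image continuous_on_subset[OF f]) auto
    then obtain B where B: "B > 0" "\<And>t. t \<in> {0..T} \<Longrightarrow> norm (f t) \<le> B"
      using bounded_pos[of "f ` {0..T}"] compact_imp_bounded by blast
    then have "norm (indicator {0..} t *\<^sub>R f t) \<le> B" if "t \<le> T" for t
      using that by (auto split: split_indicator)
    then show ?thesis by blast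
  qed
  ultimately show ?thesis by (simp add: loc_bdd_def)
qed

lemma rl_integral_eq_kconv:
  fixes f :: "real \<Rightarrow> complex"
  assumes a: "a > 0" and f: "continuous_on {0..} f" and t: "t \<ge> 0"
  shows "rl_integral a f t = kconv (rl_kernel a) (\<lambda>t. indicator {0..} t *\<^sub>R f t) t"
proof -
  let ?f = "\<lambda>t. indicator {0..} t *\<^sub>R f t" and ?g = "\<lambda>s. of_real ((t - s) powr (a - 1)) * f s"
  have G: "Gamma a \<noteq> 0" using Gamma_real_pos[OF a] by linarith
  \<comment> \<open>Exact even at s = t: there \<open>powr\<close> has base 0 and
    \<open>rl_kernel\<close> has argument 0, and both are 0.\<close>
  have eq: "indicator {0..t} s *\<^sub>R ?g s = of_real (Gamma a) * (rl_kernel a (t - s) *\<^sub>R ?f s)" for s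
    using G by (auto simp: rl_kernel_def scaleR_conv_of_real split: split_indicator)
  \<comment> \<open>Absolute integrability identifies the gauge integral in
    \<open>rl_integral\<close> with the Lebesgue integral in \<open>kconv\<close>.\<close>
  have int: "set_integrable lborel {0..t} ?g"
    unfolding set_integrable_def eq
    by (intro integrable_mult_right kconv_integrable rl_kernel_loc_int causal_extension_loc_bdd a f)
  have "integral {0..t} ?g = (\<integral>s. of_real (Gamma a) * (rl_kernel a (t - s) *\<^sub>R ?f s) \<partial>lborel)"
    using set_borel_integral_eq_integral(2)[OF int] unfolding set_lebesgue_integral_def eq by (rule sym)
  also have "\<dots> = of_real (Gamma a) * kconv (rl_kernel a) ?f t"
    unfolding kconv_def by (rule integral_mult_right_zero)
  finally have "integral {0..t} ?g = of_real (Gamma a) * kconv (rl_kernel a) ?f t" .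
  then show ?thesis using G by (simp add: rl_integral_def)
qed

text \<open>A companion system: component \<open>m > 0\<close> of block \<open>j\<close> is the fractional integral of order
  $(r_j - m)\delta$ of the right-hand side \<open>j\<close>.\<close>

lemma caputo_solution_tendsto_zero:
  fixes r :: "nat \<Rightarrow> nat" and g :: "nat \<Rightarrow> real \<Rightarrow> complex"
  assumes sol: "caputo_solution d A \<alpha> g x0 x"
    and g: "\<And>i. i < d \<Longrightarrow> continuous_on {0..} (g i)" "\<And>i. i < d \<Longrightarrow> (g i \<longlongrightarrow> 0) at_top"
    and \<delta>: "\<delta> > 0" and r: "\<And>j. j < d \<Longrightarrow> r j > 0"
    and \<alpha>: "\<And>j. j < d \<Longrightarrow> \<alpha> j = real (r j) * \<delta>"
    and spec: "\<And>l. eigenvalue (star_mat d A r) l \<Longrightarrow> \<exists>n>0. real n * \<delta> < 1 \<and> Re (l ^ n) < 0"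
    and i: "i < d"
  shows "(x i \<longlongrightarrow> 0) at_top"
proof -
  define off where "off j = (\<Sum>i<j. r i)" for j
  define X where "X j t = indicator {0..} t *\<^sub>R x j t" for j t
  define H where "H j t = indicator {0..} t *\<^sub>R ((\<Sum>k<d. A $$ (j, k) * x k t) + g j t)" for j t
  define g' where "g' j t = indicator {0..} t *\<^sub>R g j t" for j t
  \<comment> \<open>Only the head carries the initial value; for m = 0 the integral of order r_j
    \<delta> = \<alpha>_j would miss it by the constant \<open>x0 j\<close>.\<close>
  define Y where "Y j m t = (if m = 0 then X j t else kconv (rl_kernel (real (r j - m) * \<delta>)) (H j) t)" for j m t
  define y where "y n = Y (block_no r n) (block_pos r n)" for n
  define G where "G n t = (if Suc (block_pos r n) = r (block_no r n) then g' (block_no r n) t else 0)" for n t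
  define c where "c n = (if block_pos r n = 0 then x0 (block_no r n) else 0)" for n
  have x: "continuous_on {0..} (x j)" if "j < d" for j
    using sol that by (simp add: caputo_solution_def)
  have rhs: "continuous_on {0..} (\<lambda>t. (\<Sum>k<d. A $$ (j, k) * x k t) + g j t)" if "j < d" for j
    using that by (intro continuous_intros x g) auto
  have X: "loc_bdd (X j)" and H: "loc_bdd (H j)" and g': "loc_bdd (g' j)" if "j < d" for j
    unfolding X_def H_def g'_def by (intro causal_extension_loc_bdd x rhs g that)+
  have K: "loc_int (rl_kernel a)" if "a > 0" for a using that by (rule rl_kernel_loc_int)
  have ord: "real (r j - m) * \<delta> > 0" if "m < r j" for j m using that \<delta> by simp
  have Y: "loc_bdd (Y j m)" if "j < d" "m < r j" for j m
    using X[OF that(1)] kconv_loc_bdd[OF K[OF ord[OF that(2)]] H[OF that(1)]]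
    by (cases "m = 0") (auto simp: Y_def[abs_def])
  have H_eq: "H j t = (\<Sum>k<d. A $$ (j, k) * X k t) + g' j t" for j t
    by (cases "t \<ge> 0") (simp_all add: H_def X_def g'_def)
  have X_eq: "X j t = indicator {0..} t * x0 j + kconv (rl_kernel (real (r j) * \<delta>)) (H j) t" if j: "j < d" for j t
  proof (cases "t \<ge> 0")
    case True
    have "\<alpha> j > 0" using \<alpha>[OF j] r[OF j] \<delta> by simp
    from rl_integral_eq_kconv[OF this rhs[OF j] True]
    show ?thesis using sol j True by (simp add: caputo_solution_def X_def H_def[abs_def] \<alpha>[OF j])
  next
    case False
    have "real (r j) * \<delta> > 0" using r[OF j] \<delta> by simp
    then show ?thesis using False kconv_neg[OF K H[OF j], of "real (r j) * \<delta>" t] by (simp add: X_def)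
  qed
  \<comment> \<open>A component with index \<open>r j\<close> would be the integral of order zero,
    that is, \<open>H j\<close> itself; this closes the chain in the last row of a block.\<close>
  have Y_step: "Y j m t = indicator {0..} t * (if m = 0 then x0 j else 0) +
      kconv (rl_kernel \<delta>) (if Suc m = r j then H j else Y j (Suc m)) t"
    if j: "j < d" and m: "m < r j" for j m t
  proof -
    have "kconv (rl_kernel \<delta>) (if Suc m = r j then H j else Y j (Suc m)) t = kconv (rl_kernel (real (r j - m) * \<delta>)) (H j) t"
    proof (cases "Suc m = r j")
      case True
      then have "r j - m = 1" by simp
      then show ?thesis using True by simp
    next
      case False
      then have "Suc m < r j" using m by simp
      then have "\<delta> + real (r j - Suc m) * \<delta> = real (r j - m) * \<delta>"
        by (simp add: of_nat_diff algebra_simps)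
      moreover have "kconv (rl_kernel \<delta>) (kconv (rl_kernel (real (r j - Suc m) * \<delta>)) (H j)) t =
          kconv (rl_kernel (\<delta> + real (r j - Suc m) * \<delta>)) (H j) t"
        using kconv_rl_rl_kernel[OF \<delta> ord[OF \<open>Suc m < r j\<close>] H[OF j]] by simp
      ultimately show ?thesis using False by (simp add: Y_def[abs_def])
    qed
    then show ?thesis using X_eq[OF j, of t] by (simp add: Y_def)
  qed
  have y_off: "y (off j + m) = Y j m" if "m < r j" for j m
    using that by (simp add: y_def off_def block_no_offset block_pos_offset)
  have main: "(y n \<longlongrightarrow> 0) at_top" if "n < (\<Sum>j<d. r j)" for n
  proof (rule volterra_system_tendsto_zero[OF star_mat_carrier \<delta> spec _ _ _ _ that])
    fix n assume "n < (\<Sum>j<d. r j)"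
    then obtain j m where jm: "j < d" "m < r j" "n = off j + m"
      unfolding off_def by (rule block_index_cases)
    have pos: "block_no r n = j" "block_pos r n = m"
      using jm by (auto simp: off_def block_no_offset block_pos_offset)
    have cn: "c n = (if m = 0 then x0 j else 0)" by (simp add: c_def pos)
    show "loc_bdd (y n)" using Y[OF jm(1,2)] by (simp add: jm(3) y_off[OF jm(2)])
    show "loc_bdd (G n)" using g'[OF jm(1)] loc_bdd_zero by (cases "Suc m = r j") (simp_all add: G_def[abs_def] pos)
    have "(g' j \<longlongrightarrow> 0) at_top"
    proof (rule Lim_transform_eventually[OF g(2)[OF jm(1)]])
      show "\<forall>\<^sub>F t in at_top. g j t = g' j t"
        using eventually_ge_at_top[of 0] by eventually_elim (simp add: g'_def)
    qed
    then show "(G n \<longlongrightarrow> 0) at_top" by (cases "Suc m = r j") (simp_all add: G_def[abs_def] pos)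
    fix t
    have "(\<Sum>k<(\<Sum>j<d. r j). star_mat d A r $$ (n, k) * y k s) + G n s =
        (if Suc m = r j then H j else Y j (Suc m)) s" for s
    proof -
      have row: "(\<Sum>k<(\<Sum>j<d. r j). star_mat d A r $$ (n, k) * y k s) =
         (if Suc m = r j then \<Sum>k<d. A $$ (j, k) * y (off k) s else y (off j + Suc m) s)"
        using star_mat_row[where r = r and V = "\<lambda>k. y k s" and A = A, OF r jm(1,2)] unfolding jm(3) off_def .
      show ?thesis
      proof (cases "Suc m = r j")
        case True
        have "y (off k) s = X k s" if "k < d" for k
          using y_off[OF r[OF that]] by (simp add: Y_def)
        then show ?thesis unfolding row using True by (simp add: H_eq G_def pos)
      next
        case False
        then show ?thesis unfolding row using y_off[of "Suc m" j] jm(2) by (simp add: G_def pos)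
      qed
    qed
    then show "y n t = indicator {0..} t * c n + kconv (rl_kernel \<delta>)
        (\<lambda>s. (\<Sum>k<(\<Sum>j<d. r j). star_mat d A r $$ (n, k) * y k s) + G n s) t"
      using Y_step[OF jm(1,2), of t] cn by (simp add: jm(3) y_off[OF jm(2)])
  qed
  have "y (off i) = X i" using y_off[OF r[OF i]] by (simp add: Y_def[abs_def])
  then have "(X i \<longlongrightarrow> 0) at_top"
    using main[of "off i"] offset_less[where r = r, OF i r[OF i]] by (simp add: off_def)
  then show ?thesis
  proof (rule Lim_transform_eventually)
    show "\<forall>\<^sub>F t in at_top. X i t = x i t"
      using eventually_ge_at_top[of 0] by eventually_elim (simp add: X_def)
  qed
qed

section \<open>Arguments of powers and the choice of the refinement\<close>

lemma Arg_power_small: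
  assumes "l \<noteq> 0" "real N * \<bar>Arg l\<bar> < pi"
  shows "Arg (l ^ N) = real N * Arg l"
proof (rule Arg_unique)
  have "l = of_real (norm l) * exp (\<i> * of_real (Arg l))" using Arg_eq[OF assms(1)] by simp
  then have "l ^ N = (of_real (norm l) * exp (\<i> * of_real (Arg l))) ^ N" by simp
  also have "\<dots> = of_real (norm l ^ N) * exp (\<i> * of_real (real N * Arg l))"
    by (simp add: power_mult_distrib mult_ac flip: exp_of_nat_mult)
  finally show "complex_of_real (norm l ^ N) * exp (\<i> * complex_of_real (real N * Arg l)) = l ^ N" by simp
  have "\<bar>real N * Arg l\<bar> < pi" using assms(2) by (simp add: abs_mult)
  then show "- pi < real N * Arg l" "real N * Arg l \<le> pi" by linarith+
qed (use assms in simp)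

text \<open>Take the first multiple of |Arg l| beyond pi/2. It does not pass pi: for n = 1 because
  |Arg l| \<le> pi, and otherwise because the previous multiple, and hence also one further step, is
  at most pi/2. The previous multiple also yields (n - 1) \<phi> \<le> pi/2 and thus the bound on
  n.\<close>

lemma exists_power_left_half_plane:
  assumes l: "l \<noteq> 0" and \<phi>: "\<bar>Arg l\<bar> \<ge> \<phi>" "\<phi> > 0"
  shows "\<exists>n>0. real n \<le> pi / (2 * \<phi>) + 1 \<and> Re (l ^ n) < 0"
proof -
  define n where "n = (LEAST n. real n * \<bar>Arg l\<bar> > pi / 2)"
  obtain n0 where "real n0 * \<bar>Arg l\<bar> > pi / 2"
    using reals_Archimedean3[of "\<bar>Arg l\<bar>"] \<phi> by fastforce
  then have n: "real n * \<bar>Arg l\<bar> > pi / 2" unfolding n_def by (rule LeastI)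
  then have "n > 0" by (cases n) auto
  then have "\<not> real (n - 1) * \<bar>Arg l\<bar> > pi / 2"
    unfolding n_def by (intro not_less_Least) simp
  then have prev: "(real n - 1) * \<bar>Arg l\<bar> \<le> pi / 2" using \<open>n > 0\<close> by (simp add: of_nat_diff)
  have "(real n - 1) * \<phi> \<le> (real n - 1) * \<bar>Arg l\<bar>"
    using \<phi> \<open>n > 0\<close> by (intro mult_left_mono) auto
  with prev have "(real n - 1) * \<phi> \<le> pi / 2" by linarith
  then have "real n \<le> pi / (2 * \<phi>) + 1" using \<phi> by (simp add: field_simps)
  moreover have "Re (l ^ n) < 0"
  proof -
    have "real n * \<bar>Arg l\<bar> \<le> pi"
    proof (cases "n = 1")
      case True
      then show ?thesis using Arg_bounded[of l] by auto
    next
      case False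
      then have "1 * \<bar>Arg l\<bar> \<le> (real n - 1) * \<bar>Arg l\<bar>"
        using \<open>n > 0\<close> by (intro mult_right_mono) auto
      with prev show ?thesis by (simp add: algebra_simps)
    qed
    then have "cos (real n * \<bar>Arg l\<bar>) < cos (pi / 2)"
      using n pi_gt_zero by (intro cos_monotone_0_pi) auto
    moreover have "cos (real n * \<bar>Arg l\<bar>) = cos (real n * Arg l)"
      by (cases "Arg l \<ge> 0") auto
    moreover have "Re (l ^ n) = norm l ^ n * cos (real n * Arg l)"
    proof -
      have "l = of_real (norm l) * exp (\<i> * of_real (Arg l))" using Arg_eq[OF l] by simp
      then have "l = rcis (norm l) (Arg l)" by (simp add: rcis_def cis_conv_exp)
      then have "l ^ n = rcis (norm l ^ n) (real n * Arg l)" by (metis DeMoivre2)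
      then show ?thesis by simp
    qed
    ultimately show ?thesis using l by (simp add: mult_pos_neg)
  qed
  ultimately show ?thesis using \<open>n > 0\<close> by blast
qed

theorem theorem3p5:
  fixes d q :: nat
    and A :: "complex mat"
    and g :: "nat \<Rightarrow> real \<Rightarrow> complex"
    and \<alpha> :: "nat \<Rightarrow> real"
    and \<alpha>s :: real
    and \<rho> :: "nat \<Rightarrow> rat"
    and p qs r :: "nat \<Rightarrow> nat"
  assumes "d \<ge> 1"
    and "A \<in> carrier_mat d d"
    and "\<And>i. i < d \<Longrightarrow> continuous_on {0..} (g i)"
    and "\<And>i. i < d \<Longrightarrow> (g i \<longlongrightarrow> 0) at_top"
    and "\<And>j. j < d \<Longrightarrow> 0 < \<alpha> j \<and> \<alpha> j \<le> 1"
    and "0 < \<alpha>s" and "\<alpha>s \<le> 1"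
    and "\<And>j. j < d \<Longrightarrow> \<alpha> j = of_rat (\<rho> j) * \<alpha>s"
    and "\<And>j. j < d \<Longrightarrow> 0 < p j \<and> 0 < qs j \<and> coprime (p j) (qs j) \<and> \<rho> j = of_nat (p j) / of_nat (qs j)"
    and "q = Lcm (qs ` {..<d})"
    and "\<And>j. j < d \<Longrightarrow> r j = p j * q div qs j"
    and "\<And>l. eigenvalue (star_mat d A r) l \<Longrightarrow> l \<noteq> 0 \<and> \<bar>Arg l\<bar> > pi * \<alpha>s / (2 * real q)"
  shows "\<forall>x0 x. caputo_solution d A \<alpha> g x0 x \<longrightarrow> (\<forall>i<d. (x i \<longlongrightarrow> 0) at_top)"
proof (intro allI impI)
  fix x0 x i
  assume sol: "caputo_solution d A \<alpha> g x0 x" and i: "i < d"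
  have q: "q > 0"
  proof -
    have "qs j > 0" if "j < d" for j using assms(9)[OF that] by simp
    then have "0 \<notin> qs ` {..<d}" by force
    then show ?thesis unfolding assms(10) by (intro Nat.gr0I) (simp add: Lcm_0_iff)
  qed
  define \<beta> where "\<beta> = \<alpha>s / real q"
  have \<beta>: "0 < \<beta>" "\<beta> \<le> 1" using assms(6,7) q by (auto simp: \<beta>_def divide_le_eq)
  have r: "r j > 0" and \<alpha>: "\<alpha> j = real (r j) * \<beta>" if j: "j < d" for j
  proof -
    have pq: "0 < p j" "0 < qs j" "\<rho> j = of_nat (p j) / of_nat (qs j)" using assms(9)[OF j] by auto
    have "qs j dvd q" unfolding assms(10) using j by (intro dvd_Lcm) auto
    then obtain k where k: "q = qs j * k" by (auto simp: dvd_def)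
    then have rj: "r j = p j * k" using assms(11)[OF j] pq by (simp add: mult.left_commute)
    then show "r j > 0" using k q pq by simp
    show "\<alpha> j = real (r j) * \<beta>"
      using assms(8)[OF j] k q pq rj by (simp add: \<beta>_def of_rat_divide field_simps)
  qed
  let ?S = "star_mat d A r"
  define \<Lambda> where "\<Lambda> = {l. eigenvalue ?S l}"
  have "finite \<Lambda>"
    unfolding \<Lambda>_def eigenvalue_root_char_poly[OF star_mat_carrier]
    using degree_monic_char_poly[OF star_mat_carrier[of d A r]] by (intro poly_roots_finite) auto
  \<comment> \<open>Finiteness of the spectrum makes the sector condition uniform. The cap 3 pi / 4
    exceeds pi \<beta> / 2, as \<beta> \<le> 1, and stays below pi, so that N-th powers with N |Arg
    l| < \<theta> do not wrap around.\<close>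
  define \<theta> where "\<theta> = Min (insert (3 * pi / 4) ((\<lambda>l. \<bar>Arg l\<bar>) ` \<Lambda>))"
  have \<theta>_le: "\<theta> \<le> 3 * pi / 4" "\<And>l. l \<in> \<Lambda> \<Longrightarrow> \<theta> \<le> \<bar>Arg l\<bar>"
    unfolding \<theta>_def by (rule Min_le; use \<open>finite \<Lambda>\<close> in simp)+
  have \<theta>_in: "\<theta> \<in> insert (3 * pi / 4) ((\<lambda>l. \<bar>Arg l\<bar>) ` \<Lambda>)"
    unfolding \<theta>_def using \<open>finite \<Lambda>\<close> by (intro Min_in) auto
  have A: "pi * \<beta> / 2 < 3 * pi / 4" using \<beta> pi_gt_zero mult_left_mono[OF \<beta>(2), of pi] by linarith
  have B: "pi * \<beta> / 2 < \<bar>Arg l\<bar>" if "l \<in> \<Lambda>" for l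
    using assms(12)[of l] that by (simp add: \<Lambda>_def \<beta>_def)
  have \<theta>: "pi * \<beta> / 2 < \<theta>"
    using \<theta>_in by (elim insertE imageE) (simp_all only: A B)
  have \<theta>_pos: "\<theta> > 0" using \<theta> \<beta> pi_gt_zero mult_pos_pos[of pi \<beta>] by linarith
  have "pi * \<beta> / (2 * \<theta>) < 1" using \<theta> \<theta>_pos by (simp add: field_simps)
  \<comment> \<open>This says pi \<beta> / (2 \<theta>) + \<beta> / N < 1, and the left side is the
    bound for n \<delta> at the end of \<open>spec\<close>.\<close>
  then obtain N :: nat where "\<beta> / (1 - pi * \<beta> / (2 * \<theta>)) < real N"
    using reals_Archimedean2 by blast
  moreover have "\<beta> / (1 - pi * \<beta> / (2 * \<theta>)) > 0" using \<beta> \<open>pi * \<beta> / (2 * \<theta>) < 1\<close> by simp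
  ultimately have N: "N > 0" "\<beta> < real N * (1 - pi * \<beta> / (2 * \<theta>))"
    using \<open>pi * \<beta> / (2 * \<theta>) < 1\<close> by (auto simp: field_simps intro: Nat.gr0I)
  define \<delta> where "\<delta> = \<beta> / real N"
  have \<delta>: "\<delta> > 0" using \<beta> N by (simp add: \<delta>_def)
  have spec: "\<exists>n>0. real n * \<delta> < 1 \<and> Re (l ^ n) < 0" if ev: "eigenvalue (star_mat d A (\<lambda>j. N * r j)) l" for l
  proof -
    have L: "l ^ N \<in> \<Lambda>"
      unfolding \<Lambda>_def using star_mat_eigenvalue_power[OF r N(1) ev] by simp
    then have "l ^ N \<noteq> 0" using assms(12)[of "l ^ N"] by (simp add: \<Lambda>_def)
    then have l: "l \<noteq> 0" using N by (auto simp: power_0_left)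
    \<comment> \<open>Otherwise N |Arg l| < \<theta> < pi, so Arg (l^N) = N Arg l, and l^N would be
      an eigenvalue of the unrefined matrix with argument below the minimum \<theta>.\<close>
    have "\<bar>Arg l\<bar> \<ge> \<theta> / real N"
    proof (rule ccontr)
      assume "\<not> \<bar>Arg l\<bar> \<ge> \<theta> / real N"
      then have *: "real N * \<bar>Arg l\<bar> < \<theta>" using N by (simp add: field_simps)
      then have "Arg (l ^ N) = real N * Arg l"
        using \<theta>_le(1) pi_gt_zero by (intro Arg_power_small[OF l]) linarith
      then have "\<bar>Arg (l ^ N)\<bar> < \<theta>" using * by (simp add: abs_mult)
      then show False using \<theta>_le(2)[OF L] by simp
    qed
    then obtain n where n: "n > 0" "real n \<le> pi / (2 * (\<theta> / real N)) + 1" "Re (l ^ n) < 0"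
      using exists_power_left_half_plane[OF l, of "\<theta> / real N"] \<theta>_pos N by auto
    have "real n * \<delta> \<le> (pi / (2 * (\<theta> / real N)) + 1) * \<delta>"
      using n \<delta> by (intro mult_right_mono) auto
    also have "\<dots> = pi * \<beta> / (2 * \<theta>) + \<beta> / real N"
      using N \<theta>_pos by (simp add: \<delta>_def field_simps)
    also have "\<dots> < 1" using N by (simp add: field_simps)
    finally show ?thesis using n by blast
  qed
  show "(x i \<longlongrightarrow> 0) at_top"
  proof (rule caputo_solution_tendsto_zero[OF sol assms(3,4) \<delta> _ _ spec i])
    fix j assume "j < d"
    then show "N * r j > 0" "\<alpha> j = real (N * r j) * \<delta>"
      using r \<alpha> N by (auto simp: \<delta>_def)
  qed
qed

end
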